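(* Let $\mathcal{C}$ be a skeletally small Krull-Schmidt additive category with split idempotents, and let $\mathcal{B}$ be a full additive subcategory of $\mathcal{C}$ with $\mathcal{B}=\mathrm{add}(\mathcal{B})$. Suppose we have the recollement of $\mathrm{Mod}(\mathcal{C})$ by $\mathrm{Mod}(\mathcal{C}/I_{\mathcal{B}})$ and $\mathrm{Mod}(\mathcal{B})$ given by the adjoint triples $$\left(\mathcal{C}/I_{\mathcal{B}}\otimes_{\mathcal{C}}-,\ \mathrm{res}_{\mathcal{C}},\ \mathcal{C}(\mathcal{C}/I_{\mathcal{B}},-)\right)\quad\text{and}\quad\left(\mathcal{C}\otimes_{\mathcal{B}}-,\ \mathrm{res}_{\mathcal{B}},\ \mathcal{B}(\mathcal{C},-)\right),$$ and that $\mathcal{C}(\mathcal{C}/I_{\mathcal{B}},-):\mathrm{Mod}(\mathcal{C})\to\mathrm{Mod}(\mathcal{C}/I_{\mathcal{B}})$ is an exact functor. Then there is an equivalence of categories $$\mathcal{C}\simeq \begin{bmatrix}\mathcal{B} & 0\\ \overline{\mathrm{Hom}} & {}^{\perp_0}\mathcal{B}\end{bmatrix}.$$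
   Context: Modules: for a skeletally small preadditive category $\mathcal{A}$, $\mathrm{Mod}(\mathcal{A})$ is the category of additive covariant functors $\mathcal{A}\to\mathbf{Ab}$ and natural transformations. The tensor product $\otimes_{\mathcal{A}}:\mathrm{Mod}(\mathcal{A}^{op})\times\mathrm{Mod}(\mathcal{A})\to\mathbf{Ab}$ is the (unique up to isomorphism) functor which is right exact and preserves coproducts in each variable and satisfies $F\otimes_{\mathcal{A}}\mathcal{A}(A,-)=F(A)$ and $\mathcal{A}(-,A)\otimes_{\mathcal{A}}G=G(A)$. Krull-Schmidt: every object is a finite direct sum of objects with local endomorphism ring. Idempotents split: every idempotent endomorphism has a kernel. $\mathrm{add}(\mathcal{B})$ is the full subcategory of direct summands of finite direct sums of objects of $\mathcal{B}$. Quotient: $I_{\mathcal{B}}(C,C')\subseteq\mathcal{C}(C,C')$ is the subgroup of morphisms factoring through an object of $\mathcal{B}$; it is a two-sided ideal. $\mathcal{C}/I_{\mathcal{B}}$ has the objects of $\mathcal{C}$ and morphisms $\mathcal{C}(C,C')/I_{\mathcal{B}}(C,C')$; $\pi:\mathcal{C}\to\mathcal{C}/I_{\mathcal{B}}$ is the projection. Functors: $\mathrm{res}_{\mathcal{C}}:\mathrm{Mod}(\mathcal{C}/I_{\mathcal{B}})\to\mathrm{Mod}(\mathcal{C})$, $F\mapsto F\circ\pi$; $(\mathcal{C}/I_{\mathcal{B}}\otimes_{\mathcal{C}}N)(C)=\frac{\mathcal{C}(-,C)}{I_{\mathcal{B}}(-,C)}\otimes_{\mathcal{C}}N$; $\mathcal{C}(\mathcal{C}/I_{\mathcal{B}},N)(C)=\mathrm{Hom}_{\mathrm{Mod}(\mathcal{C})}\left(\frac{\mathcal{C}(C,-)}{I_{\mathcal{B}}(C,-)},N\right)$;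 $\mathrm{res}_{\mathcal{B}}:\mathrm{Mod}(\mathcal{C})\to\mathrm{Mod}(\mathcal{B})$ is restriction; $(\mathcal{C}\otimes_{\mathcal{B}}N)(C)=\mathcal{C}(-,C)|_{\mathcal{B}}\otimes_{\mathcal{B}}N$; $\mathcal{B}(\mathcal{C},N)(C)=\mathrm{Hom}_{\mathrm{Mod}(\mathcal{B})}(\mathcal{C}(C,-)|_{\mathcal{B}},N)$. Recollement: for abelian categories $\mathcal{B}',\mathcal{A}',\mathcal{C}'$, additive functors $i_*:\mathcal{B}'\to\mathcal{A}'$, $i^*,i^!:\mathcal{A}'\to\mathcal{B}'$, $j^*:\mathcal{A}'\to\mathcal{C}'$, $j_!,j_*:\mathcal{C}'\to\mathcal{A}'$ such that $(i^*,i_*,i^!)$ and $(j_!,j^*,j_* )$ are adjoint triples, $\mathrm{Ker}(j^* )=\mathrm{Im}(i_* )$, and $i_*,j_!,j_*$ are fully faithful. Here $i_*=\mathrm{res}_{\mathcal{C}}$, $j^*=\mathrm{res}_{\mathcal{B}}$. ${}^{\perp_0}\mathcal{B}$ is the full subcategory of $\mathcal{C}$ of objects $X$ with $\mathcal{C}(X,B)=0$ for all $B\in\mathcal{B}$. Triangular matrix category: for preadditive categories $\mathcal{T},\mathcal{U}$ and an additive functor $M:\mathcal{U}\otimes\mathcal{T}^{op}\to\mathbf{Ab}$ (the category $\mathcal{U}\otimes\mathcal{T}^{op}$ has pairs $(U,T)$ as objects and tensor products of Hom groups as morphisms), the category $\begin{bmatrix}\mathcal{T} & 0 \\ M & \mathcal{U}\end{bmatrix}$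 has objects $\begin{bmatrix}T & 0 \\ M & U\end{bmatrix}$ with $T\in\mathcal{T}$, $U\in\mathcal{U}$; morphisms from $\begin{bmatrix}T & 0 \\ M & U\end{bmatrix}$ to $\begin{bmatrix}T' & 0 \\ M & U'\end{bmatrix}$ are matrices $\begin{bmatrix}t & 0 \\ m & u\end{bmatrix}$ with $t\in\mathcal{T}(T,T')$, $m\in M(U',T)$, $u\in\mathcal{U}(U,U')$; composition is $\begin{bmatrix}t_2 & 0 \\ m_2 & u_2\end{bmatrix}\circ\begin{bmatrix}t_1 & 0 \\ m_1 & u_1\end{bmatrix}=\begin{bmatrix}t_2t_1 & 0 \\ m_2\bullet t_1+u_2\bullet m_1 & u_2u_1\end{bmatrix}$ with $m_2\bullet t_1=M(1\otimes t_1^{op})(m_2)$, $u_2\bullet m_1=M(u_2\otimes1)(m_1)$. $\overline{\mathrm{Hom}}:{}^{\perp_0}\mathcal{B}\otimes\mathcal{B}^{op}\to\mathbf{Ab}$ is the restriction of the Hom functor: $\overline{\mathrm{Hom}}(U,T)=\mathrm{Hom}_{\mathcal{C}}(T,U)$ for $U\in{}^{\perp_0}\mathcal{B}$, $T\in\mathcal{B}$. *)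

theory Defs
  imports "HOL-Algebra.Free_Abelian_Groups" "HOL-Algebra.Ring"
begin

section \<open>Preadditive categories\<close>

text \<open>
  The Hom groups are written multiplicatively, as usual for groups in HOL-Algebra: the zero
  morphism is \<open>\<one>\<^bsub>Hom C X Y\<^esub>\<close> and the sum of \<open>f\<close> and \<open>g\<close> is \<open>f \<otimes>\<^bsub>Hom C X Y\<^esub> g\<close>.
  Different Hom groups need not be disjoint, so composition carries the objects along:
  \<open>Comp C X Y Z g f\<close> is the composite of \<open>f : X \<rightarrow> Y\<close> and \<open>g : Y \<rightarrow> Z\<close>.
\<close>

record ('o, 'm) category =
  Obj :: "'o set"
  Hom :: "'o \<Rightarrow> 'o \<Rightarrow> 'm monoid"
  Comp :: "'o \<Rightarrow> 'o \<Rightarrow> 'o \<Rightarrow> 'm \<Rightarrow> 'm \<Rightarrow> 'm"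
  Ident :: "'o \<Rightarrow> 'm"

abbreviation Mor :: "('o, 'm) category \<Rightarrow> 'o \<Rightarrow> 'o \<Rightarrow> 'm set"
  where "Mor C X Y \<equiv> carrier (Hom C X Y)"

locale preadditive_category =
  fixes C :: "('o, 'm) category"
  assumes hom_group: "\<lbrakk>X \<in> Obj C; Y \<in> Obj C\<rbrakk> \<Longrightarrow> comm_group (Hom C X Y)"
    and comp_closed: "\<lbrakk>X \<in> Obj C; Y \<in> Obj C; Z \<in> Obj C; f \<in> Mor C X Y; g \<in> Mor C Y Z\<rbrakk>
      \<Longrightarrow> Comp C X Y Z g f \<in> Mor C X Z"
    and ident_closed: "X \<in> Obj C \<Longrightarrow> Ident C X \<in> Mor C X X"
    and comp_assoc: "\<lbrakk>W \<in> Obj C; X \<in> Obj C; Y \<in> Obj C; Z \<in> Obj C;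
        f \<in> Mor C W X; g \<in> Mor C X Y; h \<in> Mor C Y Z\<rbrakk>
      \<Longrightarrow> Comp C W Y Z h (Comp C W X Y g f) = Comp C W X Z (Comp C X Y Z h g) f"
    and comp_ident_right: "\<lbrakk>X \<in> Obj C; Y \<in> Obj C; f \<in> Mor C X Y\<rbrakk>
      \<Longrightarrow> Comp C X X Y f (Ident C X) = f"
    and comp_ident_left: "\<lbrakk>X \<in> Obj C; Y \<in> Obj C; f \<in> Mor C X Y\<rbrakk>
      \<Longrightarrow> Comp C X Y Y (Ident C Y) f = f"
    and comp_add_right: "\<lbrakk>X \<in> Obj C; Y \<in> Obj C; Z \<in> Obj C;
        f \<in> Mor C X Y; f' \<in> Mor C X Y; g \<in> Mor C Y Z\<rbrakk>
      \<Longrightarrow> Comp C X Y Z g (f \<otimes>\<^bsub>Hom C X Y\<^esub> f')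
          = Comp C X Y Z g f \<otimes>\<^bsub>Hom C X Z\<^esub> Comp C X Y Z g f'"
    and comp_add_left: "\<lbrakk>X \<in> Obj C; Y \<in> Obj C; Z \<in> Obj C;
        f \<in> Mor C X Y; g \<in> Mor C Y Z; g' \<in> Mor C Y Z\<rbrakk>
      \<Longrightarrow> Comp C X Y Z (g \<otimes>\<^bsub>Hom C Y Z\<^esub> g') f
          = Comp C X Y Z g f \<otimes>\<^bsub>Hom C X Z\<^esub> Comp C X Y Z g' f"

definition is_iso :: "('o, 'm) category \<Rightarrow> 'o \<Rightarrow> 'o \<Rightarrow> 'm \<Rightarrow> bool"
  where "is_iso C X Y f \<longleftrightarrow> f \<in> Mor C X Y \<and>
    (\<exists>g\<in>Mor C Y X. Comp C X Y X g f = Ident C X \<and> Comp C Y X Y f g = Ident C Y)"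

definition isomorphic :: "('o, 'm) category \<Rightarrow> 'o \<Rightarrow> 'o \<Rightarrow> bool"
  where "isomorphic C X Y \<longleftrightarrow> (\<exists>f. is_iso C X Y f)"

definition zero_object :: "('o, 'm) category \<Rightarrow> 'o \<Rightarrow> bool"
  where "zero_object C X \<longleftrightarrow> X \<in> Obj C \<and>
    (\<forall>Y\<in>Obj C. Mor C X Y = {\<one>\<^bsub>Hom C X Y\<^esub>} \<and> Mor C Y X = {\<one>\<^bsub>Hom C Y X\<^esub>})"

text \<open>\<open>P\<close> is a direct sum of the finite list \<open>Xs\<close> of objects; the empty list gives zero objects.\<close>

definition direct_sum :: "('o, 'm) category \<Rightarrow> 'o list \<Rightarrow> 'o \<Rightarrow> bool"
  where "direct_sum C Xs P \<longleftrightarrow> set Xs \<subseteq> Obj C \<and> P \<in> Obj C \<and>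
    (\<exists>\<iota> \<rho>.
      (\<forall>i<length Xs. \<iota> i \<in> Mor C (Xs ! i) P \<and> \<rho> i \<in> Mor C P (Xs ! i)) \<and>
      (\<forall>i<length Xs. \<forall>j<length Xs. Comp C (Xs ! i) P (Xs ! j) (\<rho> j) (\<iota> i)
         = (if i = j then Ident C (Xs ! i) else \<one>\<^bsub>Hom C (Xs ! i) (Xs ! j)\<^esub>)) \<and>
      finprod (Hom C P P) (\<lambda>i. Comp C P (Xs ! i) P (\<iota> i) (\<rho> i)) {..<length Xs} = Ident C P)"

definition additive_category :: "('o, 'm) category \<Rightarrow> bool"
  where "additive_category C \<longleftrightarrow> preadditive_category C \<and> (\<exists>Z. zero_object C Z) \<and>
    (\<forall>X\<in>Obj C. \<forall>Y\<in>Obj C. \<exists>P. direct_sum C [X, Y] P)"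

definition is_kernel :: "('o, 'm) category \<Rightarrow> 'o \<Rightarrow> 'o \<Rightarrow> 'm \<Rightarrow> 'o \<Rightarrow> 'm \<Rightarrow> bool"
  where "is_kernel C X Y f K k \<longleftrightarrow> K \<in> Obj C \<and> k \<in> Mor C K X \<and>
    Comp C K X Y f k = \<one>\<^bsub>Hom C K Y\<^esub> \<and>
    (\<forall>W\<in>Obj C. \<forall>h\<in>Mor C W X. Comp C W X Y f h = \<one>\<^bsub>Hom C W Y\<^esub>
      \<longrightarrow> (\<exists>!h'. h' \<in> Mor C W K \<and> Comp C W K X k h' = h))"

definition is_cokernel :: "('o, 'm) category \<Rightarrow> 'o \<Rightarrow> 'o \<Rightarrow> 'm \<Rightarrow> 'o \<Rightarrow> 'm \<Rightarrow> bool"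
  where "is_cokernel C X Y f Q q \<longleftrightarrow> Q \<in> Obj C \<and> q \<in> Mor C Y Q \<and>
    Comp C X Y Q q f = \<one>\<^bsub>Hom C X Q\<^esub> \<and>
    (\<forall>W\<in>Obj C. \<forall>h\<in>Mor C Y W. Comp C X Y W h f = \<one>\<^bsub>Hom C X W\<^esub>
      \<longrightarrow> (\<exists>!h'. h' \<in> Mor C Q W \<and> Comp C Y Q W h' q = h))"

definition is_mono :: "('o, 'm) category \<Rightarrow> 'o \<Rightarrow> 'o \<Rightarrow> 'm \<Rightarrow> bool"
  where "is_mono C X Y f \<longleftrightarrow> f \<in> Mor C X Y \<and>
    (\<forall>W\<in>Obj C. \<forall>g\<in>Mor C W X. \<forall>h\<in>Mor C W X. Comp C W X Y f g = Comp C W X Y f h \<longrightarrow> g = h)"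

definition is_epi :: "('o, 'm) category \<Rightarrow> 'o \<Rightarrow> 'o \<Rightarrow> 'm \<Rightarrow> bool"
  where "is_epi C X Y f \<longleftrightarrow> f \<in> Mor C X Y \<and>
    (\<forall>W\<in>Obj C. \<forall>g\<in>Mor C Y W. \<forall>h\<in>Mor C Y W. Comp C X Y W g f = Comp C X Y W h f \<longrightarrow> g = h)"

definition abelian_category :: "('o, 'm) category \<Rightarrow> bool"
  where "abelian_category C \<longleftrightarrow> additive_category C \<and>
    (\<forall>X\<in>Obj C. \<forall>Y\<in>Obj C. \<forall>f\<in>Mor C X Y.
      (\<exists>K k. is_kernel C X Y f K k) \<and> (\<exists>Q q. is_cokernel C X Y f Q q) \<and>
      (is_mono C X Y f \<longrightarrow> (\<exists>Z\<in>Obj C. \<exists>g\<in>Mor C Y Z. is_kernel C Y Z g X f)) \<and>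
      (is_epi C X Y f \<longrightarrow> (\<exists>Z\<in>Obj C. \<exists>g\<in>Mor C Z X. is_cokernel C Z X g Y f)))"

definition short_exact :: "('o, 'm) category \<Rightarrow> 'o \<Rightarrow> 'o \<Rightarrow> 'o \<Rightarrow> 'm \<Rightarrow> 'm \<Rightarrow> bool"
  where "short_exact C X Y Z f g \<longleftrightarrow> X \<in> Obj C \<and> Y \<in> Obj C \<and> Z \<in> Obj C \<and>
    f \<in> Mor C X Y \<and> g \<in> Mor C Y Z \<and> is_kernel C Y Z g X f \<and> is_cokernel C X Y f Z g"

definition is_coproduct ::
    "('o, 'm) category \<Rightarrow> 'i set \<Rightarrow> ('i \<Rightarrow> 'o) \<Rightarrow> 'o \<Rightarrow> ('i \<Rightarrow> 'm) \<Rightarrow> bool"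
  where "is_coproduct C I X P \<iota> \<longleftrightarrow> P \<in> Obj C \<and>
    (\<forall>i\<in>I. X i \<in> Obj C \<and> \<iota> i \<in> Mor C (X i) P) \<and>
    (\<forall>Y\<in>Obj C. \<forall>f. (\<forall>i\<in>I. f i \<in> Mor C (X i) Y) \<longrightarrow>
      (\<exists>!h. h \<in> Mor C P Y \<and> (\<forall>i\<in>I. Comp C (X i) P Y h (\<iota> i) = f i)))"

definition op_cat :: "('o, 'm) category \<Rightarrow> ('o, 'm) category"
  where "op_cat C = \<lparr>Obj = Obj C, Hom = (\<lambda>X Y. Hom C Y X),
    Comp = (\<lambda>X Y Z g f. Comp C Z Y X f g), Ident = Ident C\<rparr>"

definition prod_cat ::
    "('o, 'm) category \<Rightarrow> ('p, 'n) category \<Rightarrow> ('o \<times> 'p, 'm \<times> 'n) category"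
  where "prod_cat C D = \<lparr>Obj = Obj C \<times> Obj D,
    Hom = (\<lambda>(X, X') (Y, Y'). Hom C X Y \<times>\<times> Hom D X' Y'),
    Comp = (\<lambda>(X, X') (Y, Y') (Z, Z') (g, g') (f, f'). (Comp C X Y Z g f, Comp D X' Y' Z' g' f')),
    Ident = (\<lambda>(X, X'). (Ident C X, Ident D X'))\<rparr>"

definition full_subcat :: "('o, 'm) category \<Rightarrow> 'o set \<Rightarrow> ('o, 'm) category"
  where "full_subcat C S = C\<lparr>Obj := S\<rparr>"


section \<open>Functors\<close>

record ('o, 'm, 'p, 'n) func =
  fobj :: "'o \<Rightarrow> 'p"
  fmap :: "'o \<Rightarrow> 'o \<Rightarrow> 'm \<Rightarrow> 'n"

definition is_functor ::
    "('o, 'm) category \<Rightarrow> ('p, 'n) category \<Rightarrow> ('o, 'm, 'p, 'n) func \<Rightarrow> bool"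
  where "is_functor C D F \<longleftrightarrow>
    (\<forall>X\<in>Obj C. fobj F X \<in> Obj D) \<and>
    (\<forall>X\<in>Obj C. \<forall>Y\<in>Obj C. \<forall>f\<in>Mor C X Y. fmap F X Y f \<in> Mor D (fobj F X) (fobj F Y)) \<and>
    (\<forall>X\<in>Obj C. fmap F X X (Ident C X) = Ident D (fobj F X)) \<and>
    (\<forall>X\<in>Obj C. \<forall>Y\<in>Obj C. \<forall>Z\<in>Obj C. \<forall>f\<in>Mor C X Y. \<forall>g\<in>Mor C Y Z.
      fmap F X Z (Comp C X Y Z g f)
        = Comp D (fobj F X) (fobj F Y) (fobj F Z) (fmap F Y Z g) (fmap F X Y f))"

definition additive_functor ::
    "('o, 'm) category \<Rightarrow> ('p, 'n) category \<Rightarrow> ('o, 'm, 'p, 'n) func \<Rightarrow> bool"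
  where "additive_functor C D F \<longleftrightarrow> is_functor C D F \<and>
    (\<forall>X\<in>Obj C. \<forall>Y\<in>Obj C. \<forall>f\<in>Mor C X Y. \<forall>g\<in>Mor C X Y.
      fmap F X Y (f \<otimes>\<^bsub>Hom C X Y\<^esub> g)
        = fmap F X Y f \<otimes>\<^bsub>Hom D (fobj F X) (fobj F Y)\<^esub> fmap F X Y g)"

definition id_func :: "('o, 'm, 'o, 'm) func"
  where "id_func = \<lparr>fobj = (\<lambda>X. X), fmap = (\<lambda>X Y f. f)\<rparr>"

definition comp_func ::
    "('p, 'n, 'q, 'k) func \<Rightarrow> ('o, 'm, 'p, 'n) func \<Rightarrow> ('o, 'm, 'q, 'k) func"
  where "comp_func G F = \<lparr>fobj = (\<lambda>X. fobj G (fobj F X)),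
    fmap = (\<lambda>X Y f. fmap G (fobj F X) (fobj F Y) (fmap F X Y f))\<rparr>"

definition op_func :: "('o, 'm, 'p, 'n) func \<Rightarrow> ('o, 'm, 'p, 'n) func"
  where "op_func F = \<lparr>fobj = fobj F, fmap = (\<lambda>X Y f. fmap F Y X f)\<rparr>"

definition prod_func :: "('o, 'm, 'p, 'n) func \<Rightarrow> ('o', 'm', 'p', 'n') func
    \<Rightarrow> ('o \<times> 'o', 'm \<times> 'm', 'p \<times> 'p', 'n \<times> 'n') func"
  where "prod_func F G = \<lparr>fobj = (\<lambda>(X, X'). (fobj F X, fobj G X')),
    fmap = (\<lambda>(X, X') (Y, Y') (f, f'). (fmap F X Y f, fmap G X' Y' f'))\<rparr>"

definition swap_func :: "('o \<times> 'p, 'm \<times> 'n, 'p \<times> 'o, 'n \<times> 'm) func"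
  where "swap_func = \<lparr>fobj = (\<lambda>(X, Y). (Y, X)), fmap = (\<lambda>_ _ (f, g). (g, f))\<rparr>"

definition nat_trans :: "('o, 'm) category \<Rightarrow> ('p, 'n) category
    \<Rightarrow> ('o, 'm, 'p, 'n) func \<Rightarrow> ('o, 'm, 'p, 'n) func \<Rightarrow> ('o \<Rightarrow> 'n) \<Rightarrow> bool"
  where "nat_trans C D F G \<eta> \<longleftrightarrow>
    (\<forall>X\<in>Obj C. \<eta> X \<in> Mor D (fobj F X) (fobj G X)) \<and>
    (\<forall>X\<in>Obj C. \<forall>Y\<in>Obj C. \<forall>f\<in>Mor C X Y.
      Comp D (fobj F X) (fobj G X) (fobj G Y) (fmap G X Y f) (\<eta> X)
        = Comp D (fobj F X) (fobj F Y) (fobj G Y) (\<eta> Y) (fmap F X Y f))"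

definition nat_isomorphic :: "('o, 'm) category \<Rightarrow> ('p, 'n) category
    \<Rightarrow> ('o, 'm, 'p, 'n) func \<Rightarrow> ('o, 'm, 'p, 'n) func \<Rightarrow> bool"
  where "nat_isomorphic C D F G \<longleftrightarrow>
    (\<exists>\<eta>. nat_trans C D F G \<eta> \<and> (\<forall>X\<in>Obj C. is_iso D (fobj F X) (fobj G X) (\<eta> X)))"

definition equivalent_categories :: "('o, 'm) category \<Rightarrow> ('p, 'n) category \<Rightarrow> bool"
  where "equivalent_categories C D \<longleftrightarrow> (\<exists>F G. additive_functor C D F \<and> additive_functor D C G \<and>
    nat_isomorphic C C (comp_func G F) id_func \<and> nat_isomorphic D D (comp_func F G) id_func)"

definition fully_faithful ::
    "('o, 'm) category \<Rightarrow> ('p, 'n) category \<Rightarrow> ('o, 'm, 'p, 'n) func \<Rightarrow> bool"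
  where "fully_faithful C D F \<longleftrightarrow> (\<forall>X\<in>Obj C. \<forall>Y\<in>Obj C.
    bij_betw (fmap F X Y) (Mor C X Y) (Mor D (fobj F X) (fobj F Y)))"

text \<open>\<open>F : C \<rightarrow> D\<close> is left adjoint to \<open>G : D \<rightarrow> C\<close>.\<close>

definition adjoint :: "('o, 'm) category \<Rightarrow> ('p, 'n) category
    \<Rightarrow> ('o, 'm, 'p, 'n) func \<Rightarrow> ('p, 'n, 'o, 'm) func \<Rightarrow> bool"
  where "adjoint C D F G \<longleftrightarrow> (\<exists>\<phi>.
    (\<forall>X\<in>Obj C. \<forall>Y\<in>Obj D. bij_betw (\<phi> X Y) (Mor D (fobj F X) Y) (Mor C X (fobj G Y))) \<and>
    (\<forall>X\<in>Obj C. \<forall>X'\<in>Obj C. \<forall>Y\<in>Obj D. \<forall>Y'\<in>Obj D.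
      \<forall>f\<in>Mor C X' X. \<forall>g\<in>Mor D Y Y'. \<forall>h\<in>Mor D (fobj F X) Y.
        \<phi> X' Y' (Comp D (fobj F X') Y Y' g (Comp D (fobj F X') (fobj F X) Y h (fmap F X' X f)))
          = Comp C X' (fobj G Y) (fobj G Y') (fmap G Y Y' g)
              (Comp C X' X (fobj G Y) (\<phi> X Y h) f)))"

definition exact_functor ::
    "('o, 'm) category \<Rightarrow> ('p, 'n) category \<Rightarrow> ('o, 'm, 'p, 'n) func \<Rightarrow> bool"
  where "exact_functor C D F \<longleftrightarrow> additive_functor C D F \<and>
    (\<forall>X Y Z f g. short_exact C X Y Z f g \<longrightarrow>
      short_exact D (fobj F X) (fobj F Y) (fobj F Z) (fmap F X Y f) (fmap F Y Z g))"

definition right_exact_functor ::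
    "('o, 'm) category \<Rightarrow> ('p, 'n) category \<Rightarrow> ('o, 'm, 'p, 'n) func \<Rightarrow> bool"
  where "right_exact_functor C D F \<longleftrightarrow> additive_functor C D F \<and>
    (\<forall>X Y Z f g. short_exact C X Y Z f g \<longrightarrow>
      is_cokernel D (fobj F X) (fobj F Y) (fmap F X Y f) (fobj F Z) (fmap F Y Z g))"

definition preserves_coproducts :: "'i itself
    \<Rightarrow> ('o, 'm) category \<Rightarrow> ('p, 'n) category \<Rightarrow> ('o, 'm, 'p, 'n) func \<Rightarrow> bool"
  where "preserves_coproducts _ C D F \<longleftrightarrow> (\<forall>(I :: 'i set) X P \<iota>. is_coproduct C I X P \<iota> \<longrightarrow>
      is_coproduct D I (\<lambda>i. fobj F (X i)) (fobj F P) (\<lambda>i. fmap F (X i) P (\<iota> i)))"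

definition functor_cat :: "('o, 'm) category \<Rightarrow> ('p, 'n) category
    \<Rightarrow> (('o, 'm, 'p, 'n) func, 'o \<Rightarrow> 'n) category"
  where "functor_cat C D = \<lparr>Obj = {F. additive_functor C D F},
    Hom = (\<lambda>F G. \<lparr>carrier = {\<eta> \<in> extensional (Obj C). nat_trans C D F G \<eta>},
      monoid.mult = (\<lambda>\<eta> \<theta>. \<lambda>X\<in>Obj C. \<eta> X \<otimes>\<^bsub>Hom D (fobj F X) (fobj G X)\<^esub> \<theta> X),
      one = (\<lambda>X\<in>Obj C. \<one>\<^bsub>Hom D (fobj F X) (fobj G X)\<^esub>)\<rparr>),
    Comp = (\<lambda>F G H \<theta> \<eta>. \<lambda>X\<in>Obj C. Comp D (fobj F X) (fobj G X) (fobj H X) (\<theta> X) (\<eta> X)),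
    Ident = (\<lambda>F. \<lambda>X\<in>Obj C. Ident D (fobj F X))\<rparr>"

text \<open>Composition with \<open>P : A \<rightarrow> C\<close>, from functors on \<open>C\<close> to functors on \<open>A\<close>, and composition
  of functors on \<open>A\<close> with a functor \<open>S\<close>.\<close>

definition precomp :: "('a, 'b) category \<Rightarrow> ('a, 'b, 'o, 'm) func
    \<Rightarrow> (('o, 'm, 'p, 'n) func, 'o \<Rightarrow> 'n, ('a, 'b, 'p, 'n) func, 'a \<Rightarrow> 'n) func"
  where "precomp A P = \<lparr>fobj = (\<lambda>F. comp_func F P),
    fmap = (\<lambda>F G \<eta>. \<lambda>X\<in>Obj A. \<eta> (fobj P X))\<rparr>"

definition postcomp :: "('a, 'b) category \<Rightarrow> ('p, 'n, 'q, 'k) func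
    \<Rightarrow> (('a, 'b, 'p, 'n) func, 'a \<Rightarrow> 'n, ('a, 'b, 'q, 'k) func, 'a \<Rightarrow> 'k) func"
  where "postcomp A S = \<lparr>fobj = (\<lambda>F. comp_func S F),
    fmap = (\<lambda>F G \<eta>. \<lambda>X\<in>Obj A. fmap S (fobj F X) (fobj G X) (\<eta> X))\<rparr>"


section \<open>Abelian groups and modules\<close>

text \<open>
  A type \<open>'u\<close> plays the role of the universe: \<open>ab_cat :: ('u monoid, 'u \<Rightarrow> 'u) category\<close> is the
  category of abelian groups with carrier in \<open>'u\<close>. A set is small with respect to \<open>'u\<close> if these
  groups, up to isomorphism, admit products indexed by it. For arbitrary types \<open>'o\<close> and \<open>'m\<close>,
  every set over \<open>'o\<close> or \<open>'m\<close> is small with respect to the infinite type \<open>'o \<times> 'm \<times> nat \<Rightarrow> bool\<close>.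
\<close>

definition ab_cat :: "('u monoid, 'u \<Rightarrow> 'u) category"
  where "ab_cat = \<lparr>Obj = {G. comm_group G},
    Hom = (\<lambda>G H. \<lparr>carrier = hom G H \<inter> extensional (carrier G),
      monoid.mult = (\<lambda>f g. \<lambda>x\<in>carrier G. f x \<otimes>\<^bsub>H\<^esub> g x),
      one = (\<lambda>x\<in>carrier G. \<one>\<^bsub>H\<^esub>)\<rparr>),
    Comp = (\<lambda>G H K g f. compose (carrier G) g f),
    Ident = (\<lambda>G. \<lambda>x\<in>carrier G. x)\<rparr>"

definition small :: "'u itself \<Rightarrow> 'a set \<Rightarrow> bool"
  where "small _ S \<longleftrightarrow> (S \<rightarrow>\<^sub>E (UNIV :: 'u set)) \<lesssim> (UNIV :: 'u set)"

definition skeletally_small :: "'u itself \<Rightarrow> ('o, 'm) category \<Rightarrow> bool"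
  where "skeletally_small u C \<longleftrightarrow> (\<exists>S\<subseteq>Obj C. small u S \<and>
    (\<forall>X\<in>Obj C. \<exists>Y\<in>S. isomorphic C X Y) \<and> (\<forall>X\<in>S. \<forall>Y\<in>S. small u (Mor C X Y)))"

text \<open>
  Groups such as Hom groups, groups of cosets or of natural transformations have their carriers
  in other types. The functor \<open>shrink\<close> replaces them by isomorphic groups with carrier in \<open>'u\<close>;
  it is only meaningful on groups whose carrier injects into \<open>'u\<close>.
\<close>

definition encode :: "'x monoid \<Rightarrow> 'x \<Rightarrow> 'u"
  where "encode G = (SOME c. inj_on c (carrier G))"

definition shrink_group :: "'x monoid \<Rightarrow> 'u monoid"
  where "shrink_group G = \<lparr>carrier = encode G ` carrier G,
    monoid.mult = (\<lambda>a b. encode G (inv_into (carrier G) (encode G) a \<otimes>\<^bsub>G\<^esub> inv_into (carrier G) (encode G) b)),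
    one = encode G \<one>\<^bsub>G\<^esub>\<rparr>"

definition shrink :: "('x monoid, 'x \<Rightarrow> 'x, 'u monoid, 'u \<Rightarrow> 'u) func"
  where "shrink = \<lparr>fobj = shrink_group,
    fmap = (\<lambda>G H f. \<lambda>a\<in>encode G ` carrier G. encode H (f (inv_into (carrier G) (encode G) a)))\<rparr>"

definition Mod_cat :: "('o, 'm) category
    \<Rightarrow> (('o, 'm, 'u monoid, 'u \<Rightarrow> 'u) func, 'o \<Rightarrow> 'u \<Rightarrow> 'u) category"
  where "Mod_cat A = functor_cat A ab_cat"

text \<open>\<open>hom_from A X\<close> is \<open>A(X,-)\<close> with its original Hom groups. Applied to \<open>op_cat A\<close>, it is
  \<open>A(-,X)\<close>.\<close>

definition hom_from :: "('o, 'm) category \<Rightarrow> 'o \<Rightarrow> ('o, 'm, 'm monoid, 'm \<Rightarrow> 'm) func"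
  where "hom_from A X = \<lparr>fobj = (\<lambda>Y. Hom A X Y),
    fmap = (\<lambda>Y Z g. \<lambda>f\<in>Mor A X Y. Comp A X Y Z g f)\<rparr>"

text \<open>The functor \<open>X \<mapsto> A(X,-)\<close> from \<open>op_cat A\<close> to functors on \<open>A\<close>.\<close>

definition yoneda :: "('o, 'm) category
    \<Rightarrow> ('o, 'm, ('o, 'm, 'm monoid, 'm \<Rightarrow> 'm) func, 'o \<Rightarrow> 'm \<Rightarrow> 'm) func"
  where "yoneda A = \<lparr>fobj = hom_from A,
    fmap = (\<lambda>X X' a. \<lambda>Y\<in>Obj A. \<lambda>f\<in>Mor A X Y. Comp A X' X Y f a)\<rparr>"

text \<open>For \<open>P : A \<rightarrow> D\<close>, the functor \<open>X \<mapsto> D(X,P(-))\<close> from \<open>op_cat D\<close> to \<open>Mod_cat A\<close>. With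
  \<open>op_cat\<close> and \<open>op_func\<close> it gives \<open>X \<mapsto> D(P(-),X)\<close> from \<open>D\<close> to \<open>Mod_cat (op_cat A)\<close>.\<close>

definition hom_module :: "('a, 'b) category \<Rightarrow> ('o, 'm) category \<Rightarrow> ('a, 'b, 'o, 'm) func
    \<Rightarrow> ('o, 'm, ('a, 'b, 'u monoid, 'u \<Rightarrow> 'u) func, 'a \<Rightarrow> 'u \<Rightarrow> 'u) func"
  where "hom_module A D P = comp_func (postcomp A shrink) (comp_func (precomp A P) (yoneda D))"


section \<open>Tensor product of modules\<close>

definition eval_func :: "('o, 'm) category
    \<Rightarrow> (('o, 'm, 'u monoid, 'u \<Rightarrow> 'u) func \<times> 'o, ('o \<Rightarrow> 'u \<Rightarrow> 'u) \<times> 'm, 'u monoid, 'u \<Rightarrow> 'u) func"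
  where "eval_func A = \<lparr>fobj = (\<lambda>(F, X). fobj F X),
    fmap = (\<lambda>(F, X) (F', X') (\<eta>, a).
      Comp ab_cat (fobj F X) (fobj F' X) (fobj F' X') (fmap F' X X' a) (\<eta> X))\<rparr>"

definition fix_left :: "('o, 'm) category \<Rightarrow> 'o \<Rightarrow> ('o \<times> 'p, 'm \<times> 'n, 'q, 'k) func \<Rightarrow> ('p, 'n, 'q, 'k) func"
  where "fix_left C X T = \<lparr>fobj = (\<lambda>Y. fobj T (X, Y)),
    fmap = (\<lambda>Y Y' g. fmap T (X, Y) (X, Y') (Ident C X, g))\<rparr>"

text \<open>The defining properties of \<open>T = (- \<otimes>\<^bsub>A\<^esub> -)\<close>; the two identifications
  \<open>F \<otimes>\<^bsub>A\<^esub> A(X,-) = F(X)\<close> and \<open>A(-,X) \<otimes>\<^bsub>A\<^esub> G = G(X)\<close> are isomorphisms natural in both variables.\<close>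

definition is_tensor_product :: "('o, 'm) category
    \<Rightarrow> (('o, 'm, 'u monoid, 'u \<Rightarrow> 'u) func \<times> ('o, 'm, 'u monoid, 'u \<Rightarrow> 'u) func,
        ('o \<Rightarrow> 'u \<Rightarrow> 'u) \<times> ('o \<Rightarrow> 'u \<Rightarrow> 'u), 'u monoid, 'u \<Rightarrow> 'u) func \<Rightarrow> bool"
  where "is_tensor_product A T \<longleftrightarrow>
    is_functor (prod_cat (Mod_cat (op_cat A)) (Mod_cat A)) ab_cat T \<and>
    (\<forall>F\<in>Obj (Mod_cat (op_cat A)).
      right_exact_functor (Mod_cat A) ab_cat (fix_left (Mod_cat (op_cat A)) F T) \<and>
      preserves_coproducts TYPE('u) (Mod_cat A) ab_cat (fix_left (Mod_cat (op_cat A)) F T)) \<and>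
    (\<forall>G\<in>Obj (Mod_cat A).
      right_exact_functor (Mod_cat (op_cat A)) ab_cat
        (fix_left (Mod_cat A) G (comp_func T swap_func)) \<and>
      preserves_coproducts TYPE('u) (Mod_cat (op_cat A)) ab_cat
        (fix_left (Mod_cat A) G (comp_func T swap_func))) \<and>
    nat_isomorphic (prod_cat (Mod_cat (op_cat A)) (op_cat A)) ab_cat
      (comp_func T (prod_func id_func (hom_module A A id_func)))
      (eval_func (op_cat A)) \<and>
    nat_isomorphic (prod_cat A (Mod_cat A)) ab_cat
      (comp_func T (prod_func (hom_module (op_cat A) (op_cat A) id_func) id_func))
      (comp_func (eval_func A) swap_func)"


section \<open>Change of category\<close>

text \<open>
  For an additive functor \<open>P : A \<rightarrow> D\<close>, the functor \<open>precomp A P : Mod_cat D \<rightarrow> Mod_cat A\<close> is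
  restriction along \<open>P\<close>, and

  \<^item> \<open>(tensor_up T A D P N)(X) = D(P(-),X) \<otimes>\<^bsub>A\<^esub> N\<close>,
  \<^item> \<open>(hom_up A D P N)(X) = Hom\<^bsub>Mod A\<^esub>(D(X,P(-)), N)\<close>.

  For the projection \<open>\<pi> : C \<rightarrow> C/I\<close> the bimodule \<open>(C/I)(X,\<pi>(-))\<close> is \<open>C(X,-)/I(X,-)\<close>, and for the
  inclusion of a full subcategory \<open>B\<close> of \<open>C\<close> it is the restriction of \<open>C(X,-)\<close> to \<open>B\<close>.
\<close>

definition tensor_up :: "(('a, 'b, 'u monoid, 'u \<Rightarrow> 'u) func \<times> ('a, 'b, 'u monoid, 'u \<Rightarrow> 'u) func,
      ('a \<Rightarrow> 'u \<Rightarrow> 'u) \<times> ('a \<Rightarrow> 'u \<Rightarrow> 'u), 'u monoid, 'u \<Rightarrow> 'u) func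
    \<Rightarrow> ('a, 'b) category \<Rightarrow> ('o, 'm) category \<Rightarrow> ('a, 'b, 'o, 'm) func
    \<Rightarrow> (('a, 'b, 'u monoid, 'u \<Rightarrow> 'u) func, 'a \<Rightarrow> 'u \<Rightarrow> 'u,
        ('o, 'm, 'u monoid, 'u \<Rightarrow> 'u) func, 'o \<Rightarrow> 'u \<Rightarrow> 'u) func"
  where "tensor_up T A D P = (let L = hom_module (op_cat A) (op_cat D) (op_func P) in
    \<lparr>fobj = (\<lambda>N. \<lparr>fobj = (\<lambda>X. fobj T (fobj L X, N)),
        fmap = (\<lambda>X Y d. fmap T (fobj L X, N) (fobj L Y, N) (fmap L X Y d, Ident (Mod_cat A) N))\<rparr>),
     fmap = (\<lambda>N N' \<eta>. \<lambda>X\<in>Obj D. fmap T (fobj L X, N) (fobj L X, N')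
        (Ident (Mod_cat (op_cat A)) (fobj L X), \<eta>))\<rparr>)"

text \<open>\<open>yoneda (op_cat (Mod_cat A))\<close> sends \<open>N\<close> to \<open>Hom\<^bsub>Mod A\<^esub>(-,N)\<close>, which is then composed with
  \<open>X \<mapsto> D(X,P(-))\<close>.\<close>

definition hom_up :: "('a, 'b) category \<Rightarrow> ('o, 'm) category \<Rightarrow> ('a, 'b, 'o, 'm) func
    \<Rightarrow> (('a, 'b, 'u monoid, 'u \<Rightarrow> 'u) func, 'a \<Rightarrow> 'u \<Rightarrow> 'u,
        ('o, 'm, 'u monoid, 'u \<Rightarrow> 'u) func, 'o \<Rightarrow> 'u \<Rightarrow> 'u) func"
  where "hom_up A D P = comp_func (postcomp D shrink)
    (comp_func (precomp D (op_func (hom_module A D P))) (yoneda (op_cat (Mod_cat A))))"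


section \<open>Recollements\<close>

text \<open>As usual, the image of a functor is closed under isomorphism.\<close>

definition recollement ::
    "('b, 'bm) category \<Rightarrow> ('a, 'am) category \<Rightarrow> ('c, 'cm) category
    \<Rightarrow> ('a, 'am, 'b, 'bm) func \<Rightarrow> ('b, 'bm, 'a, 'am) func \<Rightarrow> ('a, 'am, 'b, 'bm) func
    \<Rightarrow> ('c, 'cm, 'a, 'am) func \<Rightarrow> ('a, 'am, 'c, 'cm) func \<Rightarrow> ('c, 'cm, 'a, 'am) func \<Rightarrow> bool"
  where "recollement B A C i_upstar i_star i_shriek j_shriek j_upstar j_star \<longleftrightarrow>
    abelian_category B \<and> abelian_category A \<and> abelian_category C \<and>
    additive_functor A B i_upstar \<and> additive_functor B A i_star \<and> additive_functor A B i_shriek \<and>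
    additive_functor C A j_shriek \<and> additive_functor A C j_upstar \<and> additive_functor C A j_star \<and>
    adjoint A B i_upstar i_star \<and> adjoint B A i_star i_shriek \<and>
    adjoint C A j_shriek j_upstar \<and> adjoint A C j_upstar j_star \<and>
    {X \<in> Obj A. zero_object C (fobj j_upstar X)}
      = {X \<in> Obj A. \<exists>Y\<in>Obj B. isomorphic A (fobj i_star Y) X} \<and>
    fully_faithful B A i_star \<and> fully_faithful C A j_shriek \<and> fully_faithful C A j_star"


section \<open>Krull-Schmidt categories, quotients and subcategories\<close>

definition End_ring :: "('o, 'm) category \<Rightarrow> 'o \<Rightarrow> 'm ring"
  where "End_ring C X = \<lparr>carrier = Mor C X X, monoid.mult = Comp C X X X, one = Ident C X,
    zero = \<one>\<^bsub>Hom C X X\<^esub>, add = monoid.mult (Hom C X X)\<rparr>"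

definition local_ring :: "'m ring \<Rightarrow> bool"
  where "local_ring R \<longleftrightarrow> ring R \<and> \<one>\<^bsub>R\<^esub> \<noteq> \<zero>\<^bsub>R\<^esub> \<and>
    (\<forall>x\<in>carrier R - Units R. \<forall>y\<in>carrier R - Units R. x \<oplus>\<^bsub>R\<^esub> y \<notin> Units R)"

definition krull_schmidt :: "('o, 'm) category \<Rightarrow> bool"
  where "krull_schmidt C \<longleftrightarrow> (\<forall>X\<in>Obj C. \<exists>Xs. direct_sum C Xs X \<and>
    (\<forall>Y\<in>set Xs. local_ring (End_ring C Y)))"

definition split_idempotents :: "('o, 'm) category \<Rightarrow> bool"
  where "split_idempotents C \<longleftrightarrow> (\<forall>X\<in>Obj C. \<forall>e\<in>Mor C X X. Comp C X X X e e = e \<longrightarrow>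
    (\<exists>K k. is_kernel C X X e K k))"

definition add_closure :: "('o, 'm) category \<Rightarrow> 'o set \<Rightarrow> 'o set"
  where "add_closure C B = {X \<in> Obj C. \<exists>Bs P Y. set Bs \<subseteq> B \<and> direct_sum C Bs P \<and> direct_sum C [X, Y] P}"

definition factor_ideal :: "('o, 'm) category \<Rightarrow> 'o set \<Rightarrow> 'o \<Rightarrow> 'o \<Rightarrow> 'm set"
  where "factor_ideal C B X Y =
    {f \<in> Mor C X Y. \<exists>Z\<in>B. \<exists>g\<in>Mor C X Z. \<exists>h\<in>Mor C Z Y. f = Comp C X Z Y h g}"

text \<open>The union in the composition runs over equal cosets.\<close>

definition quotient_cat :: "('o, 'm) category \<Rightarrow> ('o \<Rightarrow> 'o \<Rightarrow> 'm set) \<Rightarrow> ('o, 'm set) category"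
  where "quotient_cat C J = \<lparr>Obj = Obj C, Hom = (\<lambda>X Y. Hom C X Y Mod J X Y),
    Comp = (\<lambda>X Y Z K L. \<Union>g\<in>K. \<Union>f\<in>L. J X Z #>\<^bsub>Hom C X Z\<^esub> Comp C X Y Z g f),
    Ident = (\<lambda>X. J X X #>\<^bsub>Hom C X X\<^esub> Ident C X)\<rparr>"

definition quotient_func ::
    "('o, 'm) category \<Rightarrow> ('o \<Rightarrow> 'o \<Rightarrow> 'm set) \<Rightarrow> ('o, 'm, 'o, 'm set) func"
  where "quotient_func C J = \<lparr>fobj = (\<lambda>X. X), fmap = (\<lambda>X Y f. J X Y #>\<^bsub>Hom C X Y\<^esub> f)\<rparr>"

definition left_perp :: "('o, 'm) category \<Rightarrow> 'o set \<Rightarrow> 'o set"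
  where "left_perp C B = {X \<in> Obj C. \<forall>Y\<in>B. Mor C X Y = {\<one>\<^bsub>Hom C X Y\<^esub>}}"


section \<open>Tensor products of categories and triangular matrix categories\<close>

definition bilinear_relations :: "('a, 'x) monoid_scheme \<Rightarrow> ('b, 'y) monoid_scheme \<Rightarrow> ('a \<times> 'b \<Rightarrow>\<^sub>0 int) set"
  where "bilinear_relations G H =
    {frag_of (a \<otimes>\<^bsub>G\<^esub> a', b) - frag_of (a, b) - frag_of (a', b) |a a' b.
      a \<in> carrier G \<and> a' \<in> carrier G \<and> b \<in> carrier H} \<union>
    {frag_of (a, b \<otimes>\<^bsub>H\<^esub> b') - frag_of (a, b) - frag_of (a, b') |a b b'.
      a \<in> carrier G \<and> b \<in> carrier H \<and> b' \<in> carrier H}"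

definition tensor_kernel :: "'a monoid \<Rightarrow> 'b monoid \<Rightarrow> ('a \<times> 'b \<Rightarrow>\<^sub>0 int) set"
  where "tensor_kernel G H =
    generate (free_Abelian_group (carrier G \<times> carrier H)) (bilinear_relations G H)"

definition tensor_group :: "'a monoid \<Rightarrow> 'b monoid \<Rightarrow> ('a \<times> 'b \<Rightarrow>\<^sub>0 int) set monoid"
  where "tensor_group G H = free_Abelian_group (carrier G \<times> carrier H) Mod tensor_kernel G H"

definition pure_tensor :: "'a monoid \<Rightarrow> 'b monoid \<Rightarrow> 'a \<Rightarrow> 'b \<Rightarrow> ('a \<times> 'b \<Rightarrow>\<^sub>0 int) set"
  where "pure_tensor G H a b =
    tensor_kernel G H #>\<^bsub>free_Abelian_group (carrier G \<times> carrier H)\<^esub> frag_of (a, b)"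

text \<open>The homomorphism from a tensor product to the abelian group \<open>K\<close> induced by a biadditive map
  \<open>\<beta>\<close>, computed on a representative \<open>c\<close> of the coset \<open>t\<close>.\<close>

definition tensor_lift :: "'c monoid \<Rightarrow> ('a \<Rightarrow> 'b \<Rightarrow> 'c) \<Rightarrow> ('a \<times> 'b \<Rightarrow>\<^sub>0 int) set \<Rightarrow> 'c"
  where "tensor_lift K \<beta> t = (let c = (SOME c. c \<in> t) in
    finprod K (\<lambda>(a, b). \<beta> a b [^]\<^bsub>K\<^esub> Poly_Mapping.lookup c (a, b)) (Poly_Mapping.keys c))"

definition tensor_cat :: "('o, 'm) category \<Rightarrow> ('p, 'n) category
    \<Rightarrow> ('o \<times> 'p, ('m \<times> 'n \<Rightarrow>\<^sub>0 int) set) category"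
  where "tensor_cat U V = \<lparr>Obj = Obj U \<times> Obj V,
    Hom = (\<lambda>(X, X') (Y, Y'). tensor_group (Hom U X Y) (Hom V X' Y')),
    Comp = (\<lambda>(X, X') (Y, Y') (Z, Z') t s.
      tensor_lift (tensor_group (Hom U X Z) (Hom V X' Z'))
        (\<lambda>g g'. tensor_lift (tensor_group (Hom U X Z) (Hom V X' Z'))
          (\<lambda>f f'. pure_tensor (Hom U X Z) (Hom V X' Z')
            (Comp U X Y Z g f) (Comp V X' Y' Z' g' f')) s) t),
    Ident = (\<lambda>(X, X'). pure_tensor (Hom U X X) (Hom V X' X') (Ident U X) (Ident V X'))\<rparr>"

text \<open>The functor \<open>(U,T) \<mapsto> C(T,U)\<close> on \<open>tensor_cat C (op_cat C)\<close>, sending \<open>u \<otimes> t\<close> to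
  \<open>m \<mapsto> u m t\<close>. The same data restrict to full subcategories.\<close>

definition hom_bifunctor :: "('o, 'm) category
    \<Rightarrow> ('o \<times> 'o, ('m \<times> 'm \<Rightarrow>\<^sub>0 int) set, 'm monoid, 'm \<Rightarrow> 'm) func"
  where "hom_bifunctor C = \<lparr>fobj = (\<lambda>(U, T). Hom C T U),
    fmap = (\<lambda>(U, T) (U', T'). tensor_lift (Hom ab_cat (Hom C T U) (Hom C T' U'))
      (\<lambda>u t. \<lambda>m\<in>Mor C T U. Comp C T' T U' (Comp C T U U' u m) t))\<rparr>"

text \<open>\<open>tri_matrix_cat T U M\<close>, for an additive functor \<open>M\<close> from \<open>tensor_cat U (op_cat T)\<close> to abelian
  groups: \<open>(X, X')\<close> is the object with diagonal entries \<open>X \<in> T\<close> and \<open>X' \<in> U\<close>, and \<open>(t, m, u)\<close>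
  the morphism with diagonal entries \<open>t\<close>, \<open>u\<close> and lower left entry \<open>m\<close>.\<close>

definition act_right :: "('t, 'tm) category \<Rightarrow> ('u, 'um) category
    \<Rightarrow> ('u \<times> 't, ('um \<times> 'tm \<Rightarrow>\<^sub>0 int) set, 'x monoid, 'x \<Rightarrow> 'x) func
    \<Rightarrow> 't \<Rightarrow> 't \<Rightarrow> 'u \<Rightarrow> 'x \<Rightarrow> 'tm \<Rightarrow> 'x"
  where "act_right T U M X Y Z m t =
    fmap M (Z, Y) (Z, X) (pure_tensor (Hom U Z Z) (Hom (op_cat T) Y X) (Ident U Z) t) m"

definition act_left :: "('t, 'tm) category \<Rightarrow> ('u, 'um) category
    \<Rightarrow> ('u \<times> 't, ('um \<times> 'tm \<Rightarrow>\<^sub>0 int) set, 'x monoid, 'x \<Rightarrow> 'x) func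
    \<Rightarrow> 't \<Rightarrow> 'u \<Rightarrow> 'u \<Rightarrow> 'um \<Rightarrow> 'x \<Rightarrow> 'x"
  where "act_left T U M X Y Z u m =
    fmap M (Y, X) (Z, X) (pure_tensor (Hom U Y Z) (Hom (op_cat T) X X) u (Ident (op_cat T) X)) m"

definition tri_matrix_cat :: "('t, 'tm) category \<Rightarrow> ('u, 'um) category
    \<Rightarrow> ('u \<times> 't, ('um \<times> 'tm \<Rightarrow>\<^sub>0 int) set, 'x monoid, 'x \<Rightarrow> 'x) func
    \<Rightarrow> ('t \<times> 'u, 'tm \<times> 'x \<times> 'um) category"
  where "tri_matrix_cat T U M = \<lparr>Obj = Obj T \<times> Obj U,
    Hom = (\<lambda>(X, X') (Y, Y'). Hom T X Y \<times>\<times> (fobj M (Y', X) \<times>\<times> Hom U X' Y')),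
    Comp = (\<lambda>(X, X') (Y, Y') (Z, Z') (t2, m2, u2) (t1, m1, u1).
      (Comp T X Y Z t2 t1,
       act_right T U M X Y Z' m2 t1 \<otimes>\<^bsub>fobj M (Z', X)\<^esub> act_left T U M X Y' Z' u2 m1,
       Comp U X' Y' Z' u2 u1)),
    Ident = (\<lambda>(X, X'). (Ident T X, \<one>\<^bsub>fobj M (X', X)\<^esub>, Ident U X'))\<rparr>"

end

theory Submission
  imports Defs
begin

text \<open>
  Evaluating the exact functor \<open>C(C/I\<^sub>B,-)\<close> on \<open>C(X,-) \<rightarrow> C(X,-)/I\<^sub>B(X,-)\<close> splits this epimorphism. By the
  Yoneda lemma the splitting is an endomorphism \<open>e\<close> of \<open>X\<close> with \<open>1 - e \<in> I\<^sub>B(X,X)\<close> and \<open>f e = 0\<close> for all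
  \<open>f \<in> I\<^sub>B(X,-)\<close>; in particular \<open>e\<close> is idempotent. Splitting \<open>1 - e\<close> and \<open>e\<close> yields \<open>X = K \<oplus> L\<close>, where
  \<open>K\<close> is a retract of an object of \<open>B\<close> and every morphism from \<open>L\<close> to an object of \<open>B\<close> vanishes.
  Hence the morphisms between such sums are triangular matrices.
\<close>

section \<open>Abelian groups and their tensor products\<close>

text \<open>Exactness in \<open>Mod_cat\<close> is phrased by kernels and cokernels, while the lift
  is an element of a Hom group. Two translations bridge this: a pointwise surjection is the cokernel
  of its pointwise kernel, and every cokernel of modules is pointwise surjective. For N =
  C(X,-)/I(X,-), exactness then makes Hom(N, C(X,-)) -> Hom(N, N) surjective, this being the value
  of the functor at X. The obstacle is size. Groups from other types enter \<open>'u\<close> through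
  encodings chosen by \<open>SOME\<close>, and equal encodings may be cancelled only once an
  embedding into \<open>'u\<close> is exhibited. For Hom groups of C it comes from skeletal
  smallness; for Hom(N, N) it comes from N being generated by the class of the identity of X.
  Between sums K + L and K' + L', the vanishing entry is L -> K', while K -> L' survives; hence B
  sits in the upper left corner and the lower left entry is Hom(T,U). Identities in the matrix
  category are read off from C through these sums.\<close>

lemma ab_cat_simps [simp]:
  "Obj ab_cat = {G. comm_group G}"
  "Mor ab_cat G H = hom G H \<inter> extensional (carrier G)"
  "f \<otimes>\<^bsub>Hom ab_cat G H\<^esub> g = (\<lambda>x\<in>carrier G. f x \<otimes>\<^bsub>H\<^esub> g x)"
  "\<one>\<^bsub>Hom ab_cat G H\<^esub> = (\<lambda>x\<in>carrier G. \<one>\<^bsub>H\<^esub>)"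
  "Comp ab_cat G H K = compose (carrier G)"
  "Ident ab_cat G = (\<lambda>x\<in>carrier G. x)"
  by (simp_all add: ab_cat_def fun_eq_iff)

text \<open>Provides the target group needed to evaluate \<open>tensor_lift\<close> in
  \<open>hom_bifunctor\<close>. Negatives are formed pointwise.\<close>

lemma ab_cat_hom_group:
  assumes "comm_group G" "comm_group H"
  shows "comm_group (Hom ab_cat G H)"
proof -
  interpret G: comm_group G by fact
  interpret H: comm_group H by fact
  show ?thesis
  proof (rule comm_groupI)
    fix f assume f: "f \<in> Mor ab_cat G H"
    then have "(\<lambda>x\<in>carrier G. inv\<^bsub>H\<^esub> f x) \<in> Mor ab_cat G H"
      "(\<lambda>x\<in>carrier G. inv\<^bsub>H\<^esub> f x) \<otimes>\<^bsub>Hom ab_cat G H\<^esub> f = \<one>\<^bsub>Hom ab_cat G H\<^esub>"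
      by (auto simp: hom_def Pi_iff H.inv_mult H.m_comm fun_eq_iff)
    then show "\<exists>g\<in>Mor ab_cat G H. g \<otimes>\<^bsub>Hom ab_cat G H\<^esub> f = \<one>\<^bsub>Hom ab_cat G H\<^esub>" by blast
  qed (auto simp: hom_def Pi_iff fun_eq_iff extensional_def H.m_ac)
qed

text \<open>The universal property of the free abelian group: this is the extension of
  \<open>f\<close> from generators, written with the very product that occurs in
  \<open>tensor_lift\<close>.\<close>

lemma (in comm_group) finprod_int_pow_hom:
  assumes f: "f \<in> S \<rightarrow> carrier G"
  shows "(\<lambda>c :: _ \<Rightarrow>\<^sub>0 int. finprod G (\<lambda>s. f s [^] Poly_Mapping.lookup c s) (Poly_Mapping.keys c))
    \<in> hom (free_Abelian_group S) G"
proof (rule homI)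
  have f1: "f s \<in> carrier G" if "s \<in> S" for s
    using f that by auto
  have fS: "f s [^] (n :: int) \<in> carrier G" if "s \<in> S" for s n
    using f that by (auto intro: int_pow_closed)
  let ?h = "\<lambda>c. finprod G (\<lambda>s. f s [^] Poly_Mapping.lookup c s) (Poly_Mapping.keys c)"
  show "?h c \<in> carrier G" if "c \<in> carrier (free_Abelian_group S)" for c
    using that fS by (intro finprod_closed) auto
  have mono: "?h c = finprod G (\<lambda>s. f s [^] Poly_Mapping.lookup c s) T"
    if "Poly_Mapping.keys c \<subseteq> T" "T \<subseteq> S" "finite T" for c :: "_ \<Rightarrow>\<^sub>0 int" and T
    using that fS
    by (intro finprod_mono_neutral_cong_left) (auto simp: in_keys_iff)
  fix c d assume cd: "c \<in> carrier (free_Abelian_group S)" "d \<in> carrier (free_Abelian_group S)"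
  \<comment> \<open>Cancellation can make the support of \<open>c + d\<close> smaller than this
    union; all three products are taken over the union, where the additional factors are zeroth
    powers.\<close>
  let ?T = "Poly_Mapping.keys c \<union> Poly_Mapping.keys d"
  have T: "Poly_Mapping.keys (c + d) \<subseteq> ?T" "?T \<subseteq> S" "finite ?T"
    using cd keys_add[of c d] by auto
  have "?h (c + d) = finprod G (\<lambda>s. f s [^] Poly_Mapping.lookup (c + d) s) ?T"
    using T by (rule mono)
  also have "\<dots> = finprod G (\<lambda>s. f s [^] Poly_Mapping.lookup c s \<otimes> f s [^] Poly_Mapping.lookup d s) ?T"
    using T(2) f1 by (intro finprod_cong') (auto simp: lookup_add int_pow_mult subset_iff)
  also have "\<dots> = finprod G (\<lambda>s. f s [^] Poly_Mapping.lookup c s) ?T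
      \<otimes> finprod G (\<lambda>s. f s [^] Poly_Mapping.lookup d s) ?T"
    using T(2) fS by (intro finprod_multf) auto
  also have "\<dots> = ?h c \<otimes> ?h d"
    using T mono[of c ?T] mono[of d ?T] by simp
  finally show "?h (c \<otimes>\<^bsub>free_Abelian_group S\<^esub> d) = ?h c \<otimes> ?h d" by simp
qed

text \<open>\<open>tensor_lift\<close> evaluates on a representative picked by \<open>SOME\<close>.
  Biadditivity makes the extension \<open>h\<close> of \<beta> kill the relations, so
  \<open>h\<close> is constant on the coset and may be computed at the generator
  \<open>frag_of (a, b)\<close>.\<close>

lemma tensor_lift_pure_tensor:
  assumes G: "comm_group G" and H: "comm_group H" and K: "comm_group K"
    and closed: "\<And>a b. a \<in> carrier G \<Longrightarrow> b \<in> carrier H \<Longrightarrow> \<beta> a b \<in> carrier K"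
    and left: "\<And>a a' b. a \<in> carrier G \<Longrightarrow> a' \<in> carrier G \<Longrightarrow> b \<in> carrier H
      \<Longrightarrow> \<beta> (a \<otimes>\<^bsub>G\<^esub> a') b = \<beta> a b \<otimes>\<^bsub>K\<^esub> \<beta> a' b"
    and right: "\<And>a b b'. a \<in> carrier G \<Longrightarrow> b \<in> carrier H \<Longrightarrow> b' \<in> carrier H
      \<Longrightarrow> \<beta> a (b \<otimes>\<^bsub>H\<^esub> b') = \<beta> a b \<otimes>\<^bsub>K\<^esub> \<beta> a b'"
    and a: "a \<in> carrier G" and b: "b \<in> carrier H"
  shows "tensor_lift K \<beta> (pure_tensor G H a b) = \<beta> a b"
proof -
  interpret G: comm_group G by fact
  interpret H: comm_group H by fact
  interpret K: comm_group K by fact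
  let ?S = "carrier G \<times> carrier H"
  let ?F = "free_Abelian_group ?S"
  interpret F: comm_group ?F by (rule abelian_free_Abelian_group)
  let ?f = "\<lambda>(a, b). \<beta> a b"
  define h where "h = (\<lambda>c :: _ \<Rightarrow>\<^sub>0 int. finprod K (\<lambda>s. ?f s [^]\<^bsub>K\<^esub> Poly_Mapping.lookup c s) (Poly_Mapping.keys c))"
  have "h \<in> hom ?F K"
    unfolding h_def using closed by (intro K.finprod_int_pow_hom) auto
  then interpret h: group_hom ?F K h
    by unfold_locales
  have of: "h (frag_of (x, y)) = \<beta> x y" if "x \<in> carrier G" "y \<in> carrier H" for x y
    unfolding h_def using closed that by simp
  \<comment> \<open>The relations are written with subtraction of finitely supported functions;
    expressed as a product with a group inverse, they become accessible to the homomorphism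
    laws.\<close>
  have diff: "h (x - y - z) = \<one>\<^bsub>K\<^esub>"
    if "x \<in> carrier ?F" "y \<in> carrier ?F" "z \<in> carrier ?F" "h x = h y \<otimes>\<^bsub>K\<^esub> h z" for x y z
  proof -
    have *: "x - y - z = x \<otimes>\<^bsub>?F\<^esub> inv\<^bsub>?F\<^esub> (y \<otimes>\<^bsub>?F\<^esub> z)"
      using that F.m_closed[of y z] by (simp add: algebra_simps del: F.inv_mult_group F.inv_mult)
    have "h (x \<otimes>\<^bsub>?F\<^esub> inv\<^bsub>?F\<^esub> (y \<otimes>\<^bsub>?F\<^esub> z)) = h x \<otimes>\<^bsub>K\<^esub> inv\<^bsub>K\<^esub> (h y \<otimes>\<^bsub>K\<^esub> h z)"
      using that F.m_closed[of y z] F.inv_closed[of "y \<otimes>\<^bsub>?F\<^esub> z"]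
      by (metis h.hom_inv h.hom_mult)
    then show ?thesis
      using * that(4) h.hom_closed[OF that(1)] by (metis K.r_inv)
  qed
  have "x - y - z \<in> kernel ?F K h"
    if "x \<in> carrier ?F" "y \<in> carrier ?F" "z \<in> carrier ?F" "h x = h y \<otimes>\<^bsub>K\<^esub> h z" for x y z
    using that diff[OF that] keys_diff[of x y] keys_diff[of "x - y" z]
    unfolding kernel_def carrier_free_Abelian_group_iff mem_Collect_eq by blast
  then have rel: "bilinear_relations G H \<subseteq> kernel ?F K h"
    unfolding bilinear_relations_def by (safe; simp add: of left right closed)
  then have sub: "tensor_kernel G H \<subseteq> kernel ?F K h"
    using rel unfolding tensor_kernel_def by (intro F.generate_subgroup_incl h.subgroup_kernel)
  have "subgroup (tensor_kernel G H) ?F"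
    unfolding tensor_kernel_def
    by (rule F.generate_is_subgroup) (use rel in \<open>auto simp: kernel_def\<close>)
  \<comment> \<open>The coset is nonempty, so the \<open>SOME\<close> in \<open>tensor_lift\<close>
    really selects one of its members.\<close>
  then have "frag_of (a, b) \<in> pure_tensor G H a b"
    unfolding pure_tensor_def using a b by (intro F.rcos_self) auto
  then have "(SOME c. c \<in> pure_tensor G H a b) \<in> pure_tensor G H a b"
    by (rule someI)
  then obtain k where k: "k \<in> tensor_kernel G H"
    "(SOME c. c \<in> pure_tensor G H a b) = k \<otimes>\<^bsub>?F\<^esub> frag_of (a, b)"
    unfolding pure_tensor_def r_coset_def by auto
  have ab: "frag_of (a, b) \<in> carrier ?F" using a b by simp
  have "tensor_lift K \<beta> (pure_tensor G H a b) = h (k \<otimes>\<^bsub>?F\<^esub> frag_of (a, b))"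
    unfolding tensor_lift_def Let_def k(2) h_def by (intro arg_cong2[where f = "finprod K"]) auto
  also have "\<dots> = h k \<otimes>\<^bsub>K\<^esub> h (frag_of (a, b))"
    using k(1) sub ab by (intro h.hom_mult) (auto simp: kernel_def)
  also have "\<dots> = \<beta> a b"
    using k(1) sub a b closed by (auto simp: kernel_def of)
  finally show ?thesis .
qed


section \<open>Preadditive categories\<close>

context preadditive_category
begin

lemma hom_monoid [simp]: "\<lbrakk>X \<in> Obj C; Y \<in> Obj C\<rbrakk> \<Longrightarrow> comm_monoid (Hom C X Y)"
  and hom_is_group [simp]: "\<lbrakk>X \<in> Obj C; Y \<in> Obj C\<rbrakk> \<Longrightarrow> group (Hom C X Y)"
  using hom_group comm_group.axioms by blast+

declare hom_group [simp] comp_closed [simp] ident_closed [simp]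
  comp_ident_left [simp] comp_ident_right [simp]

lemma zero_closed [simp]: "\<lbrakk>X \<in> Obj C; Y \<in> Obj C\<rbrakk> \<Longrightarrow> \<one>\<^bsub>Hom C X Y\<^esub> \<in> Mor C X Y"
  by (simp add: group.is_monoid monoid.one_closed)

lemma add_closed [simp]:
  "\<lbrakk>X \<in> Obj C; Y \<in> Obj C; f \<in> Mor C X Y; g \<in> Mor C X Y\<rbrakk> \<Longrightarrow> f \<otimes>\<^bsub>Hom C X Y\<^esub> g \<in> Mor C X Y"
  by (simp add: group.is_monoid monoid.m_closed)

lemma minus_closed [simp]:
  "\<lbrakk>X \<in> Obj C; Y \<in> Obj C; f \<in> Mor C X Y\<rbrakk> \<Longrightarrow> inv\<^bsub>Hom C X Y\<^esub> f \<in> Mor C X Y"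
  by (simp add: group.inv_closed)

lemma add_zero [simp]:
  assumes "X \<in> Obj C" "Y \<in> Obj C" "f \<in> Mor C X Y"
  shows "f \<otimes>\<^bsub>Hom C X Y\<^esub> \<one>\<^bsub>Hom C X Y\<^esub> = f" "\<one>\<^bsub>Hom C X Y\<^esub> \<otimes>\<^bsub>Hom C X Y\<^esub> f = f"
  using assms by (simp_all add: group.is_monoid monoid.l_one monoid.r_one)

lemma add_minus [simp]:
  assumes "X \<in> Obj C" "Y \<in> Obj C" "f \<in> Mor C X Y"
  shows "f \<otimes>\<^bsub>Hom C X Y\<^esub> inv\<^bsub>Hom C X Y\<^esub> f = \<one>\<^bsub>Hom C X Y\<^esub>"
    "inv\<^bsub>Hom C X Y\<^esub> f \<otimes>\<^bsub>Hom C X Y\<^esub> f = \<one>\<^bsub>Hom C X Y\<^esub>"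
  using assms by (simp_all add: group.l_inv group.r_inv)

lemma group_hom_comp_left:
  assumes "X \<in> Obj C" "Y \<in> Obj C" "Z \<in> Obj C" "g \<in> Mor C Y Z"
  shows "group_hom (Hom C X Y) (Hom C X Z) (Comp C X Y Z g)"
  using assms by (auto simp: group_hom_def group_hom_axioms_def hom_def comp_add_right)

lemma group_hom_comp_right:
  assumes "X \<in> Obj C" "Y \<in> Obj C" "Z \<in> Obj C" "f \<in> Mor C X Y"
  shows "group_hom (Hom C Y Z) (Hom C X Z) (\<lambda>g. Comp C X Y Z g f)"
  using assms by (auto simp: group_hom_def group_hom_axioms_def hom_def comp_add_left)

lemma comp_zero [simp]:
  assumes "X \<in> Obj C" "Y \<in> Obj C" "Z \<in> Obj C"
  shows "g \<in> Mor C Y Z \<Longrightarrow> Comp C X Y Z g \<one>\<^bsub>Hom C X Y\<^esub> = \<one>\<^bsub>Hom C X Z\<^esub>"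
    and "f \<in> Mor C X Y \<Longrightarrow> Comp C X Y Z \<one>\<^bsub>Hom C Y Z\<^esub> f = \<one>\<^bsub>Hom C X Z\<^esub>"
  using assms group_hom.hom_one[OF group_hom_comp_left] group_hom.hom_one[OF group_hom_comp_right]
  by blast+

lemma comp_minus:
  assumes "X \<in> Obj C" "Y \<in> Obj C" "Z \<in> Obj C" "f \<in> Mor C X Y" "g \<in> Mor C Y Z"
  shows "Comp C X Y Z g (inv\<^bsub>Hom C X Y\<^esub> f) = inv\<^bsub>Hom C X Z\<^esub> (Comp C X Y Z g f)"
    and "Comp C X Y Z (inv\<^bsub>Hom C Y Z\<^esub> g) f = inv\<^bsub>Hom C X Z\<^esub> (Comp C X Y Z g f)"
  using assms group_hom.hom_inv[OF group_hom_comp_left] group_hom.hom_inv[OF group_hom_comp_right]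
  by blast+

lemma is_isoI:
  "\<lbrakk>f \<in> Mor C X Y; g \<in> Mor C Y X; Comp C X Y X g f = Ident C X; Comp C Y X Y f g = Ident C Y\<rbrakk>
    \<Longrightarrow> is_iso C X Y f"
  unfolding is_iso_def by blast

end


subsection \<open>Biproducts\<close>

text \<open>The two-term case of \<open>direct_sum\<close> with named structure maps in place of
  indexed families, so that their relations can serve as simp rules.\<close>

locale biproduct = preadditive_category +
  fixes X Y P i1 i2 p1 p2
  assumes obj [simp]: "X \<in> Obj C" "Y \<in> Obj C" "P \<in> Obj C"
    and mor [simp]: "i1 \<in> Mor C X P" "i2 \<in> Mor C Y P" "p1 \<in> Mor C P X" "p2 \<in> Mor C P Y"
    and p1_i1 [simp]: "Comp C X P X p1 i1 = Ident C X"
    and p2_i2 [simp]: "Comp C Y P Y p2 i2 = Ident C Y"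
    and p2_i1 [simp]: "Comp C X P Y p2 i1 = \<one>\<^bsub>Hom C X Y\<^esub>"
    and p1_i2 [simp]: "Comp C Y P X p1 i2 = \<one>\<^bsub>Hom C Y X\<^esub>"
    and sum: "Comp C P X P i1 p1 \<otimes>\<^bsub>Hom C P P\<^esub> Comp C P Y P i2 p2 = Ident C P"

lemma (in preadditive_category) direct_sum_iff_biproduct:
  "direct_sum C [X, Y] P \<longleftrightarrow> (\<exists>i1 i2 p1 p2. biproduct C X Y P i1 i2 p1 p2)"
proof
  have lt2: "{..<length [X, Y]} = {0, 1}" by auto
  have lt2': "{..<Suc (Suc 0)} = {0, Suc 0}" by auto
  {
    assume "direct_sum C [X, Y] P"
    then obtain \<iota> \<rho> where obj: "set [X, Y] \<subseteq> Obj C" "P \<in> Obj C"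
      and mor: "\<forall>i<length [X, Y]. \<iota> i \<in> Mor C ([X, Y] ! i) P \<and> \<rho> i \<in> Mor C P ([X, Y] ! i)"
      and comp: "\<forall>i<length [X, Y]. \<forall>j<length [X, Y]. Comp C ([X, Y] ! i) P ([X, Y] ! j) (\<rho> j) (\<iota> i)
         = (if i = j then Ident C ([X, Y] ! i) else \<one>\<^bsub>Hom C ([X, Y] ! i) ([X, Y] ! j)\<^esub>)"
      and sum: "finprod (Hom C P P) (\<lambda>i. Comp C P ([X, Y] ! i) P (\<iota> i) (\<rho> i)) {..<length [X, Y]}
        = Ident C P"
      unfolding direct_sum_def by blast
    interpret PP: comm_group "Hom C P P" using obj by simp
    have mor': "\<iota> 0 \<in> Mor C X P" "\<iota> 1 \<in> Mor C Y P" "\<rho> 0 \<in> Mor C P X" "\<rho> 1 \<in> Mor C P Y"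
      using mor[rule_format, of 0] mor[rule_format, of 1] by auto
    have "biproduct C X Y P (\<iota> 0) (\<iota> 1) (\<rho> 0) (\<rho> 1)"
      using obj mor' sum comp[rule_format, of 0 0] comp[rule_format, of 0 1]
        comp[rule_format, of 1 0] comp[rule_format, of 1 1]
      unfolding lt2 by unfold_locales (auto simp: PP.finprod_insert)
    then show "\<exists>i1 i2 p1 p2. biproduct C X Y P i1 i2 p1 p2" by blast
  next
    assume "\<exists>i1 i2 p1 p2. biproduct C X Y P i1 i2 p1 p2"
    then obtain i1 i2 p1 p2 where "biproduct C X Y P i1 i2 p1 p2" by blast
    then interpret biproduct C X Y P i1 i2 p1 p2 .
    interpret PP: comm_group "Hom C P P" by simp
    show "direct_sum C [X, Y] P"
      unfolding direct_sum_def
      by (intro conjI; (rule exI[of _ "\<lambda>i. [i1, i2] ! i"], rule exI[of _ "\<lambda>i. [p1, p2] ! i"])?)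
        (auto simp: lt2' PP.finprod_insert sum less_Suc_eq)
  }
qed

lemma (in preadditive_category) direct_sum_singleton:
  assumes X: "X \<in> Obj C"
  shows "direct_sum C [X] X"
proof -
  interpret XX: comm_group "Hom C X X" using X by simp
  show ?thesis
    unfolding direct_sum_def using X
    by (intro conjI exI[of _ "\<lambda>_. Ident C X"]) (auto simp: lessThan_Suc)
qed

context biproduct
begin

lemma proj_incl_comp [simp]:
  assumes "W \<in> Obj C"
  shows "f \<in> Mor C W X \<Longrightarrow> Comp C W P X p1 (Comp C W X P i1 f) = f"
    and "g \<in> Mor C W Y \<Longrightarrow> Comp C W P Y p2 (Comp C W Y P i2 g) = g"
    and "f \<in> Mor C W X \<Longrightarrow> Comp C W P Y p2 (Comp C W X P i1 f) = \<one>\<^bsub>Hom C W Y\<^esub>"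
    and "g \<in> Mor C W Y \<Longrightarrow> Comp C W P X p1 (Comp C W Y P i2 g) = \<one>\<^bsub>Hom C W X\<^esub>"
  using assms by (simp_all add: comp_assoc)

text \<open>Insert the identity of P, written as i1 p1 + i2 p2, between \<open>g\<close> and
  \<open>f\<close>. This is the product of a row with a column, the source of matrix multiplication
  below; an identity for \<open>f\<close> or \<open>g\<close> gives the two decompositions that
  follow.\<close>

lemma comp_through:
  assumes "W \<in> Obj C" "V \<in> Obj C" "f \<in> Mor C W P" "g \<in> Mor C P V"
  shows "Comp C W P V g f
    = Comp C W X V (Comp C X P V g i1) (Comp C W P X p1 f)
      \<otimes>\<^bsub>Hom C W V\<^esub> Comp C W Y V (Comp C Y P V g i2) (Comp C W P Y p2 f)"
proof -
  have "Comp C W P V g f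
      = Comp C W P V g (Comp C W P P (Comp C P X P i1 p1 \<otimes>\<^bsub>Hom C P P\<^esub> Comp C P Y P i2 p2) f)"
    using assms by (simp add: sum)
  also have "\<dots> = Comp C W P V g (Comp C W X P i1 (Comp C W P X p1 f))
      \<otimes>\<^bsub>Hom C W V\<^esub> Comp C W P V g (Comp C W Y P i2 (Comp C W P Y p2 f))"
    using assms by (simp add: comp_add_left comp_add_right flip: comp_assoc)
  finally show ?thesis using assms by (simp add: comp_assoc)
qed

lemma decompose_domain:
  assumes "V \<in> Obj C" "g \<in> Mor C P V"
  shows "Comp C P X V (Comp C X P V g i1) p1 \<otimes>\<^bsub>Hom C P V\<^esub> Comp C P Y V (Comp C Y P V g i2) p2 = g"
  using comp_through[of P V "Ident C P" g] assms by simp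

lemma decompose_codomain:
  assumes "W \<in> Obj C" "f \<in> Mor C W P"
  shows "Comp C W X P i1 (Comp C W P X p1 f) \<otimes>\<^bsub>Hom C W P\<^esub> Comp C W Y P i2 (Comp C W P Y p2 f) = f"
  using comp_through[of W P f "Ident C P"] assms by simp

end

text \<open>The maps \<open>u\<close> and \<open>v\<close> match the summands of P and Q. This
  compares an object that happens to decompose as K + L with the sum of K and L fixed by
  choice.\<close>

lemma (in preadditive_category) biproduct_unique:
  assumes "biproduct C X Y P i1 i2 p1 p2" "biproduct C X Y Q j1 j2 q1 q2"
  shows "isomorphic C P Q"
proof -
  interpret P: biproduct C X Y P i1 i2 p1 p2 by fact
  interpret Q: biproduct C X Y Q j1 j2 q1 q2 by fact
  define u where "u = Comp C P X Q j1 p1 \<otimes>\<^bsub>Hom C P Q\<^esub> Comp C P Y Q j2 p2"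
  define v where "v = Comp C Q X P i1 q1 \<otimes>\<^bsub>Hom C Q P\<^esub> Comp C Q Y P i2 q2"
  have "is_iso C P Q u"
  proof (rule is_isoI)
    show "u \<in> Mor C P Q" "v \<in> Mor C Q P" by (simp_all add: u_def v_def)
    show "Comp C P Q P v u = Ident C P" "Comp C Q P Q u v = Ident C Q"
      by (simp_all add: u_def v_def comp_add_left comp_add_right P.sum Q.sum flip: comp_assoc)
  qed
  then show ?thesis unfolding isomorphic_def by blast
qed

subsection \<open>Idempotents\<close>

lemma (in preadditive_category) idempotent_complement:
  assumes "X \<in> Obj C" "e \<in> Mor C X X" "Comp C X X X e e = e"
  defines "e' \<equiv> Ident C X \<otimes>\<^bsub>Hom C X X\<^esub> inv\<^bsub>Hom C X X\<^esub> e"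
  shows "e' \<in> Mor C X X" "Comp C X X X e' e' = e'"
    "Comp C X X X e e' = \<one>\<^bsub>Hom C X X\<^esub>" "Comp C X X X e' e = \<one>\<^bsub>Hom C X X\<^esub>"
    "e \<otimes>\<^bsub>Hom C X X\<^esub> e' = Ident C X" "e' \<otimes>\<^bsub>Hom C X X\<^esub> e = Ident C X"
proof -
  interpret XX: comm_group "Hom C X X" using assms by simp
  show cl: "e' \<in> Mor C X X" using assms by simp
  show ee': "Comp C X X X e e' = \<one>\<^bsub>Hom C X X\<^esub>"
    using assms by (simp add: comp_add_right comp_minus)
  show "Comp C X X X e' e = \<one>\<^bsub>Hom C X X\<^esub>"
    using assms by (simp add: comp_add_left comp_minus)
  show "e' \<otimes>\<^bsub>Hom C X X\<^esub> e = Ident C X"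
    using assms by (simp add: XX.m_assoc)
  then show "e \<otimes>\<^bsub>Hom C X X\<^esub> e' = Ident C X"
    using assms cl by (simp add: XX.m_comm)
  have "Comp C X X X e' e' = Comp C X X X (Ident C X) e' \<otimes>\<^bsub>Hom C X X\<^esub> inv\<^bsub>Hom C X X\<^esub> Comp C X X X e e'"
    using assms cl unfolding e'_def by (subst comp_add_left) (simp_all add: comp_minus)
  then show "Comp C X X X e' e' = e'"
    using assms(1) cl ee' by simp
qed

text \<open>Purely equational data of a retract, with \<open>k\<close> the section and
  \<open>p\<close> the retraction; \<open>split_idempotents\<close> supplies only kernels.\<close>

definition splitting :: "('o, 'm) category \<Rightarrow> 'o \<Rightarrow> 'm \<Rightarrow> 'o \<Rightarrow> 'm \<Rightarrow> 'm \<Rightarrow> bool"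
  where "splitting C X e K k p \<longleftrightarrow> K \<in> Obj C \<and> k \<in> Mor C K X \<and> p \<in> Mor C X K \<and>
    Comp C K X K p k = Ident C K \<and> Comp C X K X k p = e"

context preadditive_category
begin

text \<open>Take \<open>k\<close> to be the kernel of 1 - e. Since (1 - e) e = 0, the map
  \<open>e\<close> factors as k p; since e k = k, both p k and the identity solve the factorization
  problem for \<open>k\<close>, so uniqueness makes them equal.\<close>

lemma splitting_exists:
  assumes split: "split_idempotents C"
    and e: "X \<in> Obj C" "e \<in> Mor C X X" "Comp C X X X e e = e"
  obtains K k p where "splitting C X e K k p"
proof -
  define e' where "e' = Ident C X \<otimes>\<^bsub>Hom C X X\<^esub> inv\<^bsub>Hom C X X\<^esub> e"
  note e' = idempotent_complement[OF e, folded e'_def]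
  obtain K k where "is_kernel C X X e' K k"
    using split e(1) e' unfolding split_idempotents_def by blast
  then have K: "K \<in> Obj C" "k \<in> Mor C K X" "Comp C K X X e' k = \<one>\<^bsub>Hom C K X\<^esub>"
    and univ: "\<And>W h. W \<in> Obj C \<Longrightarrow> h \<in> Mor C W X \<Longrightarrow> Comp C W X X e' h = \<one>\<^bsub>Hom C W X\<^esub>
      \<Longrightarrow> \<exists>!h'. h' \<in> Mor C W K \<and> Comp C W K X k h' = h"
    unfolding is_kernel_def by blast+
  obtain p where p: "p \<in> Mor C X K" "Comp C X K X k p = e"
    using univ[of X e] e e' by blast
  have "Comp C K X X e k = Comp C K X X (e \<otimes>\<^bsub>Hom C X X\<^esub> e') k"
    using e K e'(1) by (subst comp_add_left) simp_all
  then have ek: "Comp C K X X e k = k"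
    using e K e'(5) by simp
  have "Comp C K K X k (Comp C K X K p k) = k"
    using K p e ek by (simp add: comp_assoc)
  then have "Comp C K X K p k = Ident C K"
    using univ[of K k] K p e by (metis comp_closed comp_ident_right ident_closed)
  then show ?thesis
    using that K p unfolding splitting_def by blast
qed

text \<open>The mixed composites vanish by orthogonality of \<open>e\<close> and 1 - e: q k = (q l
  q)(k p k) = q ((1 - e) e) k = 0, and likewise p l = p (e (1 - e)) l = 0.\<close>

lemma biproduct_of_splittings:
  assumes e: "X \<in> Obj C" "e \<in> Mor C X X" "Comp C X X X e e = e"
    and K: "splitting C X e K k p"
    and L: "splitting C X (Ident C X \<otimes>\<^bsub>Hom C X X\<^esub> inv\<^bsub>Hom C X X\<^esub> e) L l q"
  shows "biproduct C K L X k l p q"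
proof -
  note e' = idempotent_complement[OF e]
  have obj: "K \<in> Obj C" "L \<in> Obj C" and mor: "k \<in> Mor C K X" "p \<in> Mor C X K" "l \<in> Mor C L X" "q \<in> Mor C X L"
    using K L unfolding splitting_def by auto
  have pk: "Comp C K X K p k = Ident C K" "Comp C X K X k p = e"
    and ql: "Comp C L X L q l = Ident C L"
      "Comp C X L X l q = Ident C X \<otimes>\<^bsub>Hom C X X\<^esub> inv\<^bsub>Hom C X X\<^esub> e"
    using K L unfolding splitting_def by auto
  have "Comp C K X L q k = Comp C K X L (Comp C X L L (Comp C L X L q l) q) (Comp C K K X k (Comp C K X K p k))"
    using obj mor e(1) unfolding pk ql by simp
  also have "\<dots> = Comp C K X L q (Comp C K X X (Comp C X X X (Comp C X L X l q) (Comp C X K X k p)) k)"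
    using obj mor e(1) by (simp flip: comp_assoc)
  also have "\<dots> = \<one>\<^bsub>Hom C K L\<^esub>"
    using obj mor e(1) unfolding pk ql e'(4) by simp
  finally have qk: "Comp C K X L q k = \<one>\<^bsub>Hom C K L\<^esub>" .
  have "Comp C L X K p l = Comp C L X K (Comp C X K K (Comp C K X K p k) p) (Comp C L L X l (Comp C L X L q l))"
    using obj mor e(1) unfolding pk ql by simp
  also have "\<dots> = Comp C L X K p (Comp C L X X (Comp C X X X (Comp C X K X k p) (Comp C X L X l q)) l)"
    using obj mor e(1) by (simp flip: comp_assoc)
  also have "\<dots> = \<one>\<^bsub>Hom C L K\<^esub>"
    using obj mor e(1) unfolding pk ql e'(3) by simp
  finally have "Comp C L X K p l = \<one>\<^bsub>Hom C L K\<^esub>" .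
  then show ?thesis
    using obj mor e(1) qk pk ql e'(5) by unfold_locales auto
qed

text \<open>\<open>add_closure\<close> demands a complement, which a retract does not carry. It is
  obtained by splitting the complement of the idempotent s r of Z.\<close>

lemma retract_in_add_closure:
  assumes split: "split_idempotents C" and B: "Z \<in> B" "B \<subseteq> Obj C"
    and K: "K \<in> Obj C" "s \<in> Mor C K Z" "r \<in> Mor C Z K" "Comp C K Z K r s = Ident C K"
  shows "K \<in> add_closure C B"
proof -
  define e where "e = Comp C Z K Z s r"
  have Z: "Z \<in> Obj C" using B by blast
  have "Comp C Z Z Z e e = Comp C Z K Z s (Comp C Z K K (Comp C K Z K r s) r)"
    using Z K(1-3) unfolding e_def by (simp flip: comp_assoc)
  then have e: "e \<in> Mor C Z Z" "Comp C Z Z Z e e = e"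
    using Z K unfolding e_def by simp_all
  then obtain L l q where "splitting C Z (Ident C Z \<otimes>\<^bsub>Hom C Z Z\<^esub> inv\<^bsub>Hom C Z Z\<^esub> e) L l q"
    using splitting_exists[OF split Z] idempotent_complement[OF Z] by metis
  moreover have "splitting C Z e K s r"
    using K unfolding splitting_def e_def by blast
  ultimately have "direct_sum C [K, L] Z"
    using biproduct_of_splittings[OF Z e] direct_sum_iff_biproduct by blast
  then show ?thesis
    unfolding add_closure_def using direct_sum_singleton[OF Z] B(1) K(1)
    by (intro CollectI conjI exI[of _ "[Z]"] exI[of _ Z] exI[of _ L]) auto
qed

text \<open>The splitting of \<open>X\<close> by the idempotents \<open>1 - e\<close>, which generates \<open>I(X,-)\<close>, and \<open>e\<close>.\<close>

lemma decomposition_of_idempotent: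
  assumes split: "split_idempotents C" and B: "B \<subseteq> Obj C" "add_closure C B = B"
    and X: "X \<in> Obj C" and e: "e \<in> Mor C X X"
    and fac: "Ident C X \<otimes>\<^bsub>Hom C X X\<^esub> inv\<^bsub>Hom C X X\<^esub> e \<in> factor_ideal C B X X"
    and ann: "\<And>Y f. Y \<in> Obj C \<Longrightarrow> f \<in> factor_ideal C B X Y \<Longrightarrow> Comp C X X Y f e = \<one>\<^bsub>Hom C X Y\<^esub>"
  shows "\<exists>K\<in>B. \<exists>L\<in>left_perp C B. \<exists>k l p q. biproduct C K L X k l p q"
proof -
  define e' where "e' = Ident C X \<otimes>\<^bsub>Hom C X X\<^esub> inv\<^bsub>Hom C X X\<^esub> e"
  interpret XX: comm_group "Hom C X X" using X by simp
  have e'cl: "e' \<in> Mor C X X" using X e by (simp add: e'_def)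
  \<comment> \<open>The annihilation property applied to 1 - e itself, which lies in the ideal; it
    says that e e = e.\<close>
  have "Comp C X X X e' e = \<one>\<^bsub>Hom C X X\<^esub>"
    using ann[OF X fac] by (simp add: e'_def)
  then have "e \<otimes>\<^bsub>Hom C X X\<^esub> inv\<^bsub>Hom C X X\<^esub> Comp C X X X e e = \<one>\<^bsub>Hom C X X\<^esub>"
    using X e by (simp add: e'_def comp_add_left comp_minus)
  then have idem: "Comp C X X X e e = e"
    using X e by (metis XX.inv_equality XX.inv_inv XX.inv_closed comp_closed)
  note e' = idempotent_complement[OF X e idem, folded e'_def]
  obtain K k p where K: "splitting C X e' K k p"
    using splitting_exists[OF split X e'(1,2)] .
  obtain L l q where L: "splitting C X e L l q"
    using splitting_exists[OF split X e idem] .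
  have "Ident C X \<otimes>\<^bsub>Hom C X X\<^esub> inv\<^bsub>Hom C X X\<^esub> e' = e"
    using X e e' by (metis XX.inv_solve_right ident_closed)
  then have bi: "biproduct C K L X k l p q"
    using biproduct_of_splittings[OF X e'(1,2) K] L by simp
  then interpret biproduct C K L X k l p q .
  have kp: "Comp C X K X k p = e'" "Comp C X L X l q = e"
    using K L unfolding splitting_def by auto
  obtain Z g h where Z: "Z \<in> B" "g \<in> Mor C X Z" "h \<in> Mor C Z X" "e' = Comp C X Z X h g"
    using fac unfolding factor_ideal_def e'_def by blast
  have ZC: "Z \<in> Obj C" using Z B by blast
  \<comment> \<open>K is a retract of Z with section g k and retraction p h, because p (h g) k = p
    (k p) k = 1.\<close>
  have "Comp C K Z K (Comp C Z X K p h) (Comp C K X Z g k) = Comp C K X K p (Comp C K X X e' k)"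
    using Z ZC by (simp flip: comp_assoc)
  also have "\<dots> = Ident C K"
    unfolding kp(1)[symmetric] by (simp flip: comp_assoc)
  finally have "K \<in> add_closure C B"
    using Z ZC B(1) by (intro retract_in_add_closure[OF split Z(1), of K "Comp C K X Z g k" "Comp C Z X K p h"]) auto
  moreover have "Mor C L W = {\<one>\<^bsub>Hom C L W\<^esub>}" if W: "W \<in> B" for W
  proof -
    have WC: "W \<in> Obj C" using W B by blast
    have "f = \<one>\<^bsub>Hom C L W\<^esub>" if f: "f \<in> Mor C L W" for f
    proof -
      \<comment> \<open>The map f q ends in W, which belongs to B, so it factors through B by the
        identity of W. It is therefore annihilated by e = l q, and f = f q l q l is zero.\<close>
      have "Comp C X L W f q = Comp C X W W (Ident C W) (Comp C X L W f q)"
        "Comp C X L W f q \<in> Mor C X W" "Ident C W \<in> Mor C W W"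
        using f WC by simp_all
      then have "Comp C X L W f q \<in> factor_ideal C B X W"
        unfolding factor_ideal_def using W by blast
      then have "Comp C X X W (Comp C X L W f q) e = \<one>\<^bsub>Hom C X W\<^esub>"
        using ann[OF WC] by blast
      then have "Comp C L X W (Comp C X X W (Comp C X L W f q) (Comp C X L X l q)) l = \<one>\<^bsub>Hom C L W\<^esub>"
        using WC unfolding kp by simp
      then show ?thesis using f WC by (simp flip: comp_assoc)
    qed
    then show ?thesis using WC by auto
  qed
  then have "L \<in> left_perp C B"
    unfolding left_perp_def by simp
  ultimately show ?thesis
    using bi B(2) by blast
qed

end


section \<open>A criterion for equivalence\<close>

text \<open>\<open>M\<close> identifies \<open>D\<close>, up to renaming of objects and morphisms, with the full subcategory of \<open>C\<close>
  on the objects \<open>P A\<close>.\<close>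

locale category_model = preadditive_category +
  fixes D :: "('p, 'n) category" and P :: "'p \<Rightarrow> 'a" and M :: "'p \<Rightarrow> 'p \<Rightarrow> 'b \<Rightarrow> 'n"
  assumes P_obj [simp]: "A \<in> Obj D \<Longrightarrow> P A \<in> Obj C"
    and bij: "\<lbrakk>A \<in> Obj D; A' \<in> Obj D\<rbrakk> \<Longrightarrow> bij_betw (M A A') (Mor C (P A) (P A')) (Mor D A A')"
    and M_add: "\<lbrakk>A \<in> Obj D; A' \<in> Obj D; f \<in> Mor C (P A) (P A'); g \<in> Mor C (P A) (P A')\<rbrakk>
      \<Longrightarrow> M A A' (f \<otimes>\<^bsub>Hom C (P A) (P A')\<^esub> g) = M A A' f \<otimes>\<^bsub>Hom D A A'\<^esub> M A A' g"
    and M_comp: "\<lbrakk>A \<in> Obj D; A' \<in> Obj D; A'' \<in> Obj D; f \<in> Mor C (P A) (P A'); g \<in> Mor C (P A') (P A'')\<rbrakk>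
      \<Longrightarrow> M A A'' (Comp C (P A) (P A') (P A'') g f) = Comp D A A' A'' (M A' A'' g) (M A A' f)"
    and M_ident: "A \<in> Obj D \<Longrightarrow> M A A (Ident C (P A)) = Ident D A"
    and dense: "X \<in> Obj C \<Longrightarrow> \<exists>A\<in>Obj D. isomorphic C X (P A)"
begin

definition N :: "'p \<Rightarrow> 'p \<Rightarrow> 'n \<Rightarrow> 'b"
  where "N A A' = inv_into (Mor C (P A) (P A')) (M A A')"

lemma M_closed [simp]:
  "\<lbrakk>A \<in> Obj D; A' \<in> Obj D; f \<in> Mor C (P A) (P A')\<rbrakk> \<Longrightarrow> M A A' f \<in> Mor D A A'"
  using bij by (auto simp: bij_betw_def)

lemma N_closed [simp]:
  "\<lbrakk>A \<in> Obj D; A' \<in> Obj D; m \<in> Mor D A A'\<rbrakk> \<Longrightarrow> N A A' m \<in> Mor C (P A) (P A')"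
  unfolding N_def using bij by (metis bij_betw_imp_surj_on inv_into_into)

lemma M_N [simp]: "\<lbrakk>A \<in> Obj D; A' \<in> Obj D; m \<in> Mor D A A'\<rbrakk> \<Longrightarrow> M A A' (N A A' m) = m"
  unfolding N_def using bij by (metis bij_betw_inv_into_right)

lemma N_M [simp]: "\<lbrakk>A \<in> Obj D; A' \<in> Obj D; f \<in> Mor C (P A) (P A')\<rbrakk> \<Longrightarrow> N A A' (M A A' f) = f"
  unfolding N_def using bij by (metis bij_betw_inv_into_left)

lemma N_eqI: "\<lbrakk>A \<in> Obj D; A' \<in> Obj D; f \<in> Mor C (P A) (P A'); M A A' f = m\<rbrakk> \<Longrightarrow> N A A' m = f"
  using N_M by blast

lemma N_add:
  "\<lbrakk>A \<in> Obj D; A' \<in> Obj D; m \<in> Mor D A A'; m' \<in> Mor D A A'\<rbrakk>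
    \<Longrightarrow> N A A' (m \<otimes>\<^bsub>Hom D A A'\<^esub> m') = N A A' m \<otimes>\<^bsub>Hom C (P A) (P A')\<^esub> N A A' m'"
  by (intro N_eqI) (simp_all add: M_add)

lemma N_comp:
  "\<lbrakk>A \<in> Obj D; A' \<in> Obj D; A'' \<in> Obj D; m \<in> Mor D A A'; m' \<in> Mor D A' A''\<rbrakk>
    \<Longrightarrow> N A A'' (Comp D A A' A'' m' m) = Comp C (P A) (P A') (P A'') (N A' A'' m') (N A A' m)"
  by (intro N_eqI) (simp_all add: M_comp)

lemma N_ident: "A \<in> Obj D \<Longrightarrow> N A A (Ident D A) = Ident C (P A)"
  by (intro N_eqI) (simp_all add: M_ident)

text \<open>From C to D, conjugate by chosen isomorphisms X -> P (A X) and apply \<open>M\<close>;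
  back, use \<open>P\<close> and \<open>N\<close>. Identities in D are obtained as
  \<open>M\<close>-images of identities in C, so that D needs no category laws of its own.\<close>

lemma equivalence: "equivalent_categories C D"
proof -
  have "\<forall>X\<in>Obj C. \<exists>A \<theta> \<theta>'. A \<in> Obj D \<and> \<theta> \<in> Mor C X (P A) \<and> \<theta>' \<in> Mor C (P A) X \<and>
    Comp C X (P A) X \<theta>' \<theta> = Ident C X \<and> Comp C (P A) X (P A) \<theta> \<theta>' = Ident C (P A)"
    using dense unfolding isomorphic_def is_iso_def by blast
  then obtain A \<theta> \<theta>' where "\<forall>X\<in>Obj C. A X \<in> Obj D \<and> \<theta> X \<in> Mor C X (P (A X)) \<and> \<theta>' X \<in> Mor C (P (A X)) X \<and>
    Comp C X (P (A X)) X (\<theta>' X) (\<theta> X) = Ident C X \<and>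
    Comp C (P (A X)) X (P (A X)) (\<theta> X) (\<theta>' X) = Ident C (P (A X))"
    by metis
  then have A [simp]: "A X \<in> Obj D" "\<theta> X \<in> Mor C X (P (A X))" "\<theta>' X \<in> Mor C (P (A X)) X"
    "Comp C X (P (A X)) X (\<theta>' X) (\<theta> X) = Ident C X"
    "Comp C (P (A X)) X (P (A X)) (\<theta> X) (\<theta>' X) = Ident C (P (A X))" if "X \<in> Obj C" for X
    using that by blast+
  have \<theta> [simp]: "Comp C Y (P (A X)) X (\<theta>' X) (Comp C Y X (P (A X)) (\<theta> X) f) = f"
    if "X \<in> Obj C" "Y \<in> Obj C" "f \<in> Mor C Y X" for X Y f
    using that by (simp add: comp_assoc)
  have \<theta>' [simp]: "Comp C Y X (P (A X)) (\<theta> X) (Comp C Y (P (A X)) X (\<theta>' X) f) = f"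
    if "X \<in> Obj C" "Y \<in> Obj C" "f \<in> Mor C Y (P (A X))" for X Y f
    using that by (simp add: comp_assoc)
  define conj where "conj = (\<lambda>X Y f. Comp C (P (A X)) Y (P (A Y)) (\<theta> Y) (Comp C (P (A X)) X Y f (\<theta>' X)))"
  have conj [simp]: "conj X Y f \<in> Mor C (P (A X)) (P (A Y))" if "X \<in> Obj C" "Y \<in> Obj C" "f \<in> Mor C X Y" for X Y f
    using that by (simp add: conj_def)
  define F where "F = \<lparr>fobj = A, fmap = (\<lambda>X Y f. M (A X) (A Y) (conj X Y f))\<rparr>"
  define G where "G = \<lparr>fobj = P, fmap = N\<rparr>"
  have "additive_functor C D F"
    unfolding additive_functor_def is_functor_def F_def
    by (auto simp: M_comp[symmetric] M_ident[symmetric] M_add[symmetric])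
      (simp_all add: conj_def comp_add_left comp_add_right flip: comp_assoc)
  moreover have "additive_functor D C G"
    unfolding additive_functor_def is_functor_def G_def
    by (simp add: N_add N_comp N_ident)
  moreover have "is_iso C (P (A X)) X (\<theta>' X)" if "X \<in> Obj C" for X
    using that by (intro is_isoI[of _ _ _ "\<theta> X"]) simp_all
  then have "nat_isomorphic C C (comp_func G F) id_func"
    unfolding nat_isomorphic_def nat_trans_def comp_func_def id_func_def F_def G_def
    by (intro exI[of _ \<theta>']) (simp add: conj_def flip: comp_assoc)
  moreover have "nat_isomorphic D D (comp_func F G) id_func"
  proof -
    have "is_iso D (A (P E)) E (M (A (P E)) E (\<theta>' (P E)))" if "E \<in> Obj D" for E
      using that unfolding is_iso_def
      by (intro conjI bexI[of _ "M E (A (P E)) (\<theta> (P E))"]) (simp_all flip: M_ident M_comp)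
    \<comment> \<open>A morphism \<open>m\<close> of D is M (N m), which turns the naturality square
      in D into one in C.\<close>
    moreover have "Comp D (A (P E)) E E' m (M (A (P E)) E (\<theta>' (P E)))
        = M (A (P E)) E' (Comp C (P (A (P E))) (P E) (P E') (N E E' m) (\<theta>' (P E)))"
      if "E \<in> Obj D" "E' \<in> Obj D" "m \<in> Mor D E E'" for E E' m
      using that by (simp add: M_comp)
    ultimately have "nat_isomorphic D D (comp_func F G) id_func"
      unfolding nat_isomorphic_def nat_trans_def comp_func_def id_func_def F_def G_def
      by (intro exI[of _ "\<lambda>E. M (A (P E)) E (\<theta>' (P E))"]) (simp add: conj_def flip: M_comp)
    then show ?thesis .
  qed
  ultimately show ?thesis
    unfolding equivalent_categories_def by blast
qed

end

section \<open>Triangular matrix categories\<close>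

text \<open>The assignment of m -> u m t to (u, t) is biadditive, so the lift can be evaluated on
  pure tensors. The actions \<open>act_left\<close> and \<open>act_right\<close> are the cases where
  one tensor factor is an identity.\<close>

lemma (in preadditive_category) hom_bifunctor_pure_tensor:
  assumes [simp]: "U \<in> Obj C" "U' \<in> Obj C" "T \<in> Obj C" "T' \<in> Obj C"
    and mor [simp]: "u \<in> Mor C U U'" "t \<in> Mor C T' T" "m \<in> Mor C T U"
  shows "fmap (hom_bifunctor C) (U, T) (U', T') (pure_tensor (Hom C U U') (Hom C T' T) u t) m
    = Comp C T' T U' (Comp C T U U' u m) t"
proof -
  let ?\<beta> = "\<lambda>u t. \<lambda>m\<in>Mor C T U. Comp C T' T U' (Comp C T U U' u m) t"
  let ?K = "Hom ab_cat (Hom C T U) (Hom C T' U')"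
  have K: "comm_group ?K"
    by (simp add: ab_cat_hom_group)
  have "tensor_lift ?K ?\<beta> (pure_tensor (Hom C U U') (Hom C T' T) u t) = ?\<beta> u t"
    by (rule tensor_lift_pure_tensor[OF _ _ K])
      (auto simp: hom_def comp_add_left comp_add_right fun_eq_iff)
  then show ?thesis by (simp add: hom_bifunctor_def)
qed

context preadditive_category
begin

text \<open>The sets \<open>S\<close> and \<open>S'\<close> are arbitrary because
  \<open>full_subcat\<close> changes only the set of objects, not Hom groups or composition.\<close>

lemma tri_matrix_hom_comp:
  assumes [simp]: "X \<in> Obj C" "Y \<in> Obj C" "Z \<in> Obj C" "X' \<in> Obj C" "Y' \<in> Obj C" "Z' \<in> Obj C"
    and [simp]: "t1 \<in> Mor C X Y" "t2 \<in> Mor C Y Z" "m1 \<in> Mor C X Y'" "m2 \<in> Mor C Y Z'"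
      "u1 \<in> Mor C X' Y'" "u2 \<in> Mor C Y' Z'"
  shows "Comp (tri_matrix_cat (full_subcat C S) (full_subcat C S') (hom_bifunctor C))
      (X, X') (Y, Y') (Z, Z') (t2, m2, u2) (t1, m1, u1)
    = (Comp C X Y Z t2 t1,
       Comp C X Y Z' m2 t1 \<otimes>\<^bsub>Hom C X Z'\<^esub> Comp C X Y' Z' u2 m1,
       Comp C X' Y' Z' u2 u1)"
  using hom_bifunctor_pure_tensor[of Z' Z' Y X "Ident C Z'" t1 m2]
    hom_bifunctor_pure_tensor[of Y' Z' X X u2 "Ident C X" m1]
  by (simp add: tri_matrix_cat_def act_right_def act_left_def full_subcat_def op_cat_def)
    (simp add: hom_bifunctor_def)

lemma left_perpD:
  "\<lbrakk>L \<in> left_perp C B; K \<in> B; f \<in> Mor C L K\<rbrakk> \<Longrightarrow> f = \<one>\<^bsub>Hom C L K\<^esub>"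
  unfolding left_perp_def by blast

text \<open>Choose a sum P (K, L) for each pair. A morphism between two such sums is a 2 by 2 matrix
  whose entry from L to K' vanishes, so three entries determine it and composition becomes
  multiplication of triangular matrices. By \<open>dec\<close> every object is isomorphic to a
  chosen sum.\<close>

lemma equivalent_tri_matrix_cat:
  assumes sums: "\<And>X Y. X \<in> Obj C \<Longrightarrow> Y \<in> Obj C \<Longrightarrow> \<exists>P. direct_sum C [X, Y] P"
    and B: "B \<subseteq> Obj C"
    and dec: "\<And>X. X \<in> Obj C \<Longrightarrow> \<exists>K\<in>B. \<exists>L\<in>left_perp C B. \<exists>k l p q. biproduct C K L X k l p q"
  shows "equivalent_categories C
    (tri_matrix_cat (full_subcat C B) (full_subcat C (left_perp C B)) (hom_bifunctor C))"
proof -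
  let ?D = "tri_matrix_cat (full_subcat C B) (full_subcat C (left_perp C B)) (hom_bifunctor C)"
  have obj: "Obj ?D = B \<times> left_perp C B"
    by (simp add: tri_matrix_cat_def full_subcat_def)
  have hom: "Hom ?D (X, X') (Y, Y') = Hom C X Y \<times>\<times> (Hom C X Y' \<times>\<times> Hom C X' Y')" for X X' Y Y'
    by (simp add: tri_matrix_cat_def full_subcat_def hom_bifunctor_def)
  have ident: "Ident ?D (X, X') = (Ident C X, \<one>\<^bsub>Hom C X X'\<^esub>, Ident C X')" for X X'
    by (simp add: tri_matrix_cat_def full_subcat_def hom_bifunctor_def)
  have perp: "left_perp C B \<subseteq> Obj C"
    unfolding left_perp_def by blast
  have "\<forall>A\<in>Obj ?D. \<exists>P i1 i2 p1 p2. biproduct C (fst A) (snd A) P i1 i2 p1 p2"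
    using sums B perp unfolding obj direct_sum_iff_biproduct by (auto simp: subset_iff)
  then obtain P i1 i2 p1 p2 where bip: "\<forall>A\<in>Obj ?D.
      biproduct C (fst A) (snd A) (P A) (i1 A) (i2 A) (p1 A) (p2 A)"
    by metis
  \<comment> \<open>The entries K -> K', K -> L' and L -> L' of the matrix of \<open>f\<close>, in
    the order (t, m, u) of \<open>tri_matrix_cat\<close>.\<close>
  define M where "M = (\<lambda>A A' f.
    (Comp C (fst A) (P A') (fst A') (p1 A') (Comp C (fst A) (P A) (P A') f (i1 A)),
     Comp C (fst A) (P A') (snd A') (p2 A') (Comp C (fst A) (P A) (P A') f (i1 A)),
     Comp C (snd A) (P A') (snd A') (p2 A') (Comp C (snd A) (P A) (P A') f (i2 A))))"
  have "category_model C ?D P M"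
  proof
    fix A assume A: "A \<in> Obj ?D"
    interpret A: biproduct C "fst A" "snd A" "P A" "i1 A" "i2 A" "p1 A" "p2 A"
      using bip A by blast
    show "P A \<in> Obj C" by simp
    show "M A A (Ident C (P A)) = Ident ?D A"
      by (cases A) (use A.p1_i1 A.p2_i2 A.p2_i1 A.mor A.obj in \<open>simp add: M_def ident\<close>)
    fix A' assume A': "A' \<in> Obj ?D"
    interpret A': biproduct C "fst A'" "snd A'" "P A'" "i1 A'" "i2 A'" "p1 A'" "p2 A'"
      using bip A' by blast
    have zero: "f = \<one>\<^bsub>Hom C (snd A) (fst A')\<^esub>" if "f \<in> Mor C (snd A) (fst A')" for f
      using A A' that left_perpD unfolding obj by auto
    have carr: "Mor ?D A A' = Mor C (fst A) (fst A') \<times> Mor C (fst A) (snd A') \<times> Mor C (snd A) (snd A')"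
      by (cases A; cases A') (simp add: hom)
    show "M A A' (f \<otimes>\<^bsub>Hom C (P A) (P A')\<^esub> g) = M A A' f \<otimes>\<^bsub>Hom ?D A A'\<^esub> M A A' g"
      if "f \<in> Mor C (P A) (P A')" "g \<in> Mor C (P A) (P A')" for f g
    proof -
      have "Hom ?D A A' = Hom C (fst A) (fst A') \<times>\<times> (Hom C (fst A) (snd A') \<times>\<times> Hom C (snd A) (snd A'))"
        by (cases A; cases A') (simp add: hom)
      then show ?thesis
        using that by (simp add: M_def comp_add_left comp_add_right)
    qed
    show "bij_betw (M A A') (Mor C (P A) (P A')) (Mor ?D A A')"
    proof (rule bij_betwI)
      \<comment> \<open>Reassembles the morphism as i1' t p1 + i2' m p1 + i2' u p2.\<close>
      let ?N = "\<lambda>(t, m, u). Comp C (P A) (fst A) (P A')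
        (Comp C (fst A) (fst A') (P A') (i1 A') t \<otimes>\<^bsub>Hom C (fst A) (P A')\<^esub>
         Comp C (fst A) (snd A') (P A') (i2 A') m) (p1 A)
        \<otimes>\<^bsub>Hom C (P A) (P A')\<^esub> Comp C (P A) (snd A) (P A') (Comp C (snd A) (snd A') (P A') (i2 A') u) (p2 A)"
      show "M A A' \<in> Mor C (P A) (P A') \<rightarrow> Mor ?D A A'"
        by (auto simp: M_def carr)
      show "?N \<in> Mor ?D A A' \<rightarrow> Mor C (P A) (P A')"
        by (auto simp: carr)
      show "?N (M A A' f) = f" if f: "f \<in> Mor C (P A) (P A')" for f
      proof -
        \<comment> \<open>Restricted to the summand L, the map \<open>f\<close> has no component in
          K', so it is recovered from its component in L' alone.\<close>
        have "Comp C (snd A) (snd A') (P A') (i2 A') (Comp C (snd A) (P A') (snd A') (p2 A') (Comp C (snd A) (P A) (P A') f (i2 A)))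
          = Comp C (snd A) (P A) (P A') f (i2 A)"
          using A'.decompose_codomain[of "snd A" "Comp C (snd A) (P A) (P A') f (i2 A)"] f
          by (simp add: zero[of "Comp C (snd A) (P A') (fst A') (p1 A') (Comp C (snd A) (P A) (P A') f (i2 A))"])
        then show ?thesis
          using f A'.decompose_codomain[of "fst A" "Comp C (fst A) (P A) (P A') f (i1 A)"]
            A.decompose_domain[of "P A'" f]
          by (simp add: M_def)
      qed
      show "M A A' (?N m) = m" if "m \<in> Mor ?D A A'" for m
        using that by (auto simp: carr M_def comp_add_left comp_add_right simp flip: comp_assoc)
    qed
    fix A'' assume A'': "A'' \<in> Obj ?D"
    interpret A'': biproduct C "fst A''" "snd A''" "P A''" "i1 A''" "i2 A''" "p1 A''" "p2 A''"
      using bip A'' by blast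
    have zero': "f = \<one>\<^bsub>Hom C (snd A') (fst A'')\<^esub>" if "f \<in> Mor C (snd A') (fst A'')" for f
      using A' A'' that left_perpD unfolding obj by auto
    show "M A A'' (Comp C (P A) (P A') (P A'') g f) = Comp ?D A A' A'' (M A' A'' g) (M A A' f)"
      if f: "f \<in> Mor C (P A) (P A')" and g: "g \<in> Mor C (P A') (P A'')" for f g
    proof -
      \<comment> \<open>An arbitrary entry of g f, expanded through the middle sum P A'. In the two
        diagonal entries one summand contains a vanishing factor; the entry K -> L'' retains both,
        giving m2 t1 + u2 m1.\<close>
      have "Comp C W (P A'') V p (Comp C W (P A) (P A'') (Comp C (P A) (P A') (P A'') g f) i) =
          Comp C W (fst A') V (Comp C (fst A') (P A'') V p (Comp C (fst A') (P A') (P A'') g (i1 A')))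
            (Comp C W (P A') (fst A') (p1 A') (Comp C W (P A) (P A') f i)) \<otimes>\<^bsub>Hom C W V\<^esub>
          Comp C W (snd A') V (Comp C (snd A') (P A'') V p (Comp C (snd A') (P A') (P A'') g (i2 A')))
            (Comp C W (P A') (snd A') (p2 A') (Comp C W (P A) (P A') f i))"
        if "W \<in> Obj C" "V \<in> Obj C" "p \<in> Mor C (P A'') V" "i \<in> Mor C W (P A)" for W V p i
        using that f g A'.comp_through[of W V "Comp C W (P A) (P A') f i" "Comp C (P A') (P A'') V p g"]
        by (simp flip: comp_assoc)
      note split = this
      have "Comp ?D A A' A'' (M A' A'' g) (M A A' f) =
        Comp ?D (fst A, snd A) (fst A', snd A') (fst A'', snd A'') (M A' A'' g) (M A A' f)"
        by simp
      also have "\<dots> = M A A'' (Comp C (P A) (P A') (P A'') g f)"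
        using f g unfolding M_def
        by (subst tri_matrix_hom_comp)
          (simp_all add: split zero[of "Comp C (snd A) (P A') (fst A') (p1 A') (Comp C (snd A) (P A) (P A') f (i2 A))"]
            zero'[of "Comp C (snd A') (P A'') (fst A'') (p1 A'') (Comp C (snd A') (P A') (P A'') g (i2 A'))"])
      finally show ?thesis by simp
    qed
  next
    fix X assume "X \<in> Obj C"
    then obtain K L k l p q where KL: "K \<in> B" "L \<in> left_perp C B" "biproduct C K L X k l p q"
      using dec by blast
    then have "(K, L) \<in> Obj ?D" unfolding obj by simp
    moreover from this have "isomorphic C X (P (K, L))"
      using bip KL(3) biproduct_unique by fastforce
    ultimately show "\<exists>A\<in>Obj ?D. isomorphic C X (P A)" by blast
  qed
  then show ?thesis by (rule category_model.equivalence)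
qed

end


section \<open>Quotient categories\<close>

locale category_ideal = preadditive_category +
  fixes J
  assumes J_subgroup [simp]: "\<lbrakk>X \<in> Obj C; Y \<in> Obj C\<rbrakk> \<Longrightarrow> subgroup (J X Y) (Hom C X Y)"
    and J_comp_left: "\<lbrakk>X \<in> Obj C; Y \<in> Obj C; Z \<in> Obj C; f \<in> J X Y; g \<in> Mor C Y Z\<rbrakk>
      \<Longrightarrow> Comp C X Y Z g f \<in> J X Z"
    and J_comp_right: "\<lbrakk>X \<in> Obj C; Y \<in> Obj C; Z \<in> Obj C; f \<in> Mor C X Y; g \<in> J Y Z\<rbrakk>
      \<Longrightarrow> Comp C X Y Z g f \<in> J X Z"

text \<open>The point is closure under sums: if two maps factor through W and W', their sum factors
  through a biproduct of W and W' lying in B. A zero object of B yields the zero map.\<close>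

lemma (in preadditive_category) category_ideal_factor_ideal:
  assumes B: "B \<subseteq> Obj C" "additive_category (full_subcat C B)"
  shows "category_ideal C (factor_ideal C B)"
proof (intro category_ideal.intro category_ideal_axioms.intro)
  show "preadditive_category C" by (rule preadditive_category_axioms)
  obtain Z where "zero_object (full_subcat C B) Z"
    using B(2) unfolding additive_category_def by blast
  then have Z: "Z \<in> B" "Z \<in> Obj C"
    using B(1) by (auto simp: zero_object_def full_subcat_def)
  interpret Bcat: preadditive_category "full_subcat C B"
    using B(2) unfolding additive_category_def by blast
  fix X Y assume X: "X \<in> Obj C" and Y: "Y \<in> Obj C"
  interpret XY: comm_group "Hom C X Y" using X Y by simp
  show "subgroup (factor_ideal C B X Y) (Hom C X Y)"
  proof (rule XY.subgroupI)
    show "factor_ideal C B X Y \<subseteq> Mor C X Y"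
      unfolding factor_ideal_def by blast
    have "\<one>\<^bsub>Hom C X Y\<^esub> = Comp C X Z Y \<one>\<^bsub>Hom C Z Y\<^esub> \<one>\<^bsub>Hom C X Z\<^esub>"
      using X Y Z by simp
    then have "\<one>\<^bsub>Hom C X Y\<^esub> \<in> factor_ideal C B X Y"
      unfolding factor_ideal_def using X Y Z zero_closed by blast
    then show "factor_ideal C B X Y \<noteq> {}" by blast
    fix f assume "f \<in> factor_ideal C B X Y"
    then obtain W g h where W: "W \<in> B" "g \<in> Mor C X W" "h \<in> Mor C W Y" "f = Comp C X W Y h g"
      unfolding factor_ideal_def by blast
    then have WC: "W \<in> Obj C" using B by blast
    have "inv\<^bsub>Hom C X Y\<^esub> f = Comp C X W Y (inv\<^bsub>Hom C W Y\<^esub> h) g"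
      using W WC X Y by (simp add: comp_minus)
    then show "inv\<^bsub>Hom C X Y\<^esub> f \<in> factor_ideal C B X Y"
      unfolding factor_ideal_def using W WC X Y minus_closed comp_closed by blast
    fix f' assume "f' \<in> factor_ideal C B X Y"
    then obtain W' g' h' where W': "W' \<in> B" "g' \<in> Mor C X W'" "h' \<in> Mor C W' Y" "f' = Comp C X W' Y h' g'"
      unfolding factor_ideal_def by blast
    then have W'C: "W' \<in> Obj C" using B by blast
    obtain P where "direct_sum (full_subcat C B) [W, W'] P"
      using B(2) W(1) W'(1) unfolding additive_category_def full_subcat_def by auto
    then obtain i1 i2 p1 p2 where "biproduct (full_subcat C B) W W' P i1 i2 p1 p2"
      unfolding Bcat.direct_sum_iff_biproduct by blast
    then interpret P: biproduct "full_subcat C B" W W' P i1 i2 p1 p2 .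
    have PB: "P \<in> B" using P.obj(3) by (simp add: full_subcat_def)
    \<comment> \<open>A biproduct in the full subcategory is one in C, as all the equations involve
      the same Hom groups and composition.\<close>
    have "biproduct C W W' P i1 i2 p1 p2"
      using P.mor P.p1_i1 P.p2_i2 P.p2_i1 P.p1_i2 P.sum WC W'C PB B(1)
      by unfold_locales (auto simp: full_subcat_def)
    then interpret biproduct C W W' P i1 i2 p1 p2 .
    define g'' where "g'' = Comp C X W P i1 g \<otimes>\<^bsub>Hom C X P\<^esub> Comp C X W' P i2 g'"
    define h'' where "h'' = Comp C P W Y h p1 \<otimes>\<^bsub>Hom C P Y\<^esub> Comp C P W' Y h' p2"
    have "g'' \<in> Mor C X P" "h'' \<in> Mor C P Y"
      using X Y W W' by (simp_all add: g''_def h''_def)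
    moreover have "f \<otimes>\<^bsub>Hom C X Y\<^esub> f' = Comp C X P Y h'' g''"
      using X Y W W' by (simp add: g''_def h''_def comp_add_left comp_add_right flip: comp_assoc)
    ultimately show "f \<otimes>\<^bsub>Hom C X Y\<^esub> f' \<in> factor_ideal C B X Y"
      unfolding factor_ideal_def using PB \<open>f \<in> _\<close> \<open>f' \<in> _\<close> X Y add_closed
      by (auto simp: factor_ideal_def)
  qed
  fix Z assume Z: "Z \<in> Obj C"
  show "Comp C X Y Z g f \<in> factor_ideal C B X Z" if f: "f \<in> factor_ideal C B X Y" and g: "g \<in> Mor C Y Z" for f g
  proof -
    obtain W a b where W: "W \<in> B" "a \<in> Mor C X W" "b \<in> Mor C W Y" "f = Comp C X W Y b a"
      using f unfolding factor_ideal_def by blast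
    moreover have "W \<in> Obj C" using W B by blast
    ultimately have "Comp C X Y Z g f = Comp C X W Z (Comp C W Y Z g b) a" "Comp C W Y Z g b \<in> Mor C W Z"
      "Comp C X Y Z g f \<in> Mor C X Z"
      using X Y Z g by (simp_all add: comp_assoc)
    then show ?thesis unfolding factor_ideal_def using W by blast
  qed
  show "Comp C X Y Z g f \<in> factor_ideal C B X Z" if f: "f \<in> Mor C X Y" and g: "g \<in> factor_ideal C B Y Z" for f g
  proof -
    obtain W a b where W: "W \<in> B" "a \<in> Mor C Y W" "b \<in> Mor C W Z" "g = Comp C Y W Z b a"
      using g unfolding factor_ideal_def by blast
    moreover have "W \<in> Obj C" using W B by blast
    ultimately have "Comp C X Y Z g f = Comp C X W Z b (Comp C X Y W a f)" "Comp C X Y W a f \<in> Mor C X W"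
      "Comp C X Y Z g f \<in> Mor C X Z"
      using X Y Z f by (simp_all flip: comp_assoc)
    then show ?thesis unfolding factor_ideal_def using W by blast
  qed
qed

context category_ideal
begin

abbreviation quot :: "('a, 'b set) category"
  where "quot \<equiv> quotient_cat C J"

abbreviation cls :: "'a \<Rightarrow> 'a \<Rightarrow> 'b \<Rightarrow> 'b set"
  where "cls X Y f \<equiv> J X Y #>\<^bsub>Hom C X Y\<^esub> f"

lemma quot_simps [simp]:
  "Obj quot = Obj C"
  "Hom quot X Y = Hom C X Y Mod J X Y"
  "Ident quot X = cls X X (Ident C X)"
  by (simp_all add: quotient_cat_def)

lemma J_normal [simp]: "\<lbrakk>X \<in> Obj C; Y \<in> Obj C\<rbrakk> \<Longrightarrow> J X Y \<lhd> Hom C X Y"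
  by (simp add: comm_group.subgroup_imp_normal)

lemma J_closed: "\<lbrakk>X \<in> Obj C; Y \<in> Obj C; f \<in> J X Y\<rbrakk> \<Longrightarrow> f \<in> Mor C X Y"
  using J_subgroup subgroup.mem_carrier by metis

lemma cls_add:
  "\<lbrakk>X \<in> Obj C; Y \<in> Obj C; f \<in> Mor C X Y; g \<in> Mor C X Y\<rbrakk>
    \<Longrightarrow> cls X Y f <#>\<^bsub>Hom C X Y\<^esub> cls X Y g = cls X Y (f \<otimes>\<^bsub>Hom C X Y\<^esub> g)"
  by (simp add: normal.rcos_sum)

lemma cls_eq_zero: "\<lbrakk>X \<in> Obj C; Y \<in> Obj C; f \<in> J X Y\<rbrakk> \<Longrightarrow> cls X Y f = J X Y"
  by (simp add: group.coset_join2 J_closed)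

lemma cls_eqD:
  assumes XY: "X \<in> Obj C" "Y \<in> Obj C" and f: "f \<in> Mor C X Y" and g: "g \<in> Mor C X Y"
    and eq: "cls X Y f = cls X Y g"
  shows "f \<otimes>\<^bsub>Hom C X Y\<^esub> inv\<^bsub>Hom C X Y\<^esub> g \<in> J X Y"
proof -
  interpret XY: comm_group "Hom C X Y" using XY by simp
  have "f \<in> cls X Y g"
    using XY.rcos_self[OF f J_subgroup[OF XY]] eq by simp
  then obtain j where "j \<in> J X Y" "f = j \<otimes>\<^bsub>Hom C X Y\<^esub> g"
    unfolding r_coset_def by blast
  then show ?thesis
    using XY g J_closed[OF XY] by (simp add: XY.m_assoc)
qed

lemma cls_absorb:
  assumes "X \<in> Obj C" "Y \<in> Obj C" "f \<in> Mor C X Y" "j \<in> J X Y"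
  shows "cls X Y (j \<otimes>\<^bsub>Hom C X Y\<^esub> f) = cls X Y f"
proof -
  interpret XY: comm_group "Hom C X Y" using assms by simp
  have "j \<otimes>\<^bsub>Hom C X Y\<^esub> f \<in> cls X Y f"
    using assms unfolding r_coset_def by blast
  then show ?thesis
    using XY.repr_independence assms by fastforce
qed

text \<open>Composition in the quotient is a union over all representatives. Replacing
  \<open>g\<close> by k + g and \<open>f\<close> by j + f changes g f by k (j + f) + g j, which lies
  in the ideal, so all sets in the union coincide; the union is nonempty because J is.\<close>

lemma cls_comp:
  assumes obj: "X \<in> Obj C" "Y \<in> Obj C" "Z \<in> Obj C" and f: "f \<in> Mor C X Y" and g: "g \<in> Mor C Y Z"
  shows "Comp quot X Y Z (cls Y Z g) (cls X Y f) = cls X Z (Comp C X Y Z g f)"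
proof -
  have "cls X Z (Comp C X Y Z (k \<otimes>\<^bsub>Hom C Y Z\<^esub> g) (j \<otimes>\<^bsub>Hom C X Y\<^esub> f)) = cls X Z (Comp C X Y Z g f)"
    if j: "j \<in> J X Y" and k: "k \<in> J Y Z" for j k
  proof -
    have jk: "j \<in> Mor C X Y" "k \<in> Mor C Y Z" using j k obj J_closed by auto
    have "Comp C X Y Z (k \<otimes>\<^bsub>Hom C Y Z\<^esub> g) (j \<otimes>\<^bsub>Hom C X Y\<^esub> f) =
      Comp C X Y Z k (j \<otimes>\<^bsub>Hom C X Y\<^esub> f) \<otimes>\<^bsub>Hom C X Z\<^esub> (Comp C X Y Z g j \<otimes>\<^bsub>Hom C X Z\<^esub> Comp C X Y Z g f)"
      using jk f g obj by (simp add: comp_add_left)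
        (simp add: comp_add_right)
    then show ?thesis
      using j k jk f g obj by (simp add: cls_absorb J_comp_left J_comp_right)
  qed
  moreover have "\<exists>j. j \<in> J X Y" "\<exists>k. k \<in> J Y Z"
    using obj J_subgroup subgroup.one_closed by blast+
  ultimately show ?thesis
    unfolding quotient_cat_def by (auto simp: r_coset_def[of "Hom C X Y"] r_coset_def[of "Hom C Y Z"])
qed

lemma Mor_quot: "Mor quot X Y = cls X Y ` Mor C X Y"
  by (simp add: carrier_FactGroup)

lemma quot_preadditive: "preadditive_category quot"
proof (rule preadditive_category.intro)
  show "comm_group (Hom quot X Y)" if "X \<in> Obj quot" "Y \<in> Obj quot" for X Y
    using that by (simp add: comm_group.abelian_FactGroup)
qed (auto simp: carrier_FactGroup cls_comp cls_add comp_assoc comp_add_left comp_add_right)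

lemma quotient_func_additive: "additive_functor C quot (quotient_func C J)"
  unfolding additive_functor_def is_functor_def quotient_func_def
  by (simp add: Mor_quot cls_comp cls_add del: quot_simps(2)) (simp add: cls_add)

end


section \<open>Modules\<close>

lemma additive_functor_comp:
  assumes F: "additive_functor A D F" and G: "additive_functor D E G"
  shows "additive_functor A E (comp_func G F)"
  using assms unfolding additive_functor_def is_functor_def comp_func_def by simp

lemma (in preadditive_category) hom_from_additive:
  assumes X: "X \<in> Obj C"
  shows "additive_functor C ab_cat (hom_from C X)"
  unfolding additive_functor_def is_functor_def hom_from_def using X
  by (auto simp: hom_def comp_add_left comp_add_right fun_eq_iff compose_def comp_assoc[symmetric])

lemma Mod_cat_simps [simp]:
  "Obj (Mod_cat A) = {F. additive_functor A ab_cat F}"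
  "Mor (Mod_cat A) F G = {\<eta> \<in> extensional (Obj A). nat_trans A ab_cat F G \<eta>}"
  "\<one>\<^bsub>Hom (Mod_cat A) F G\<^esub> = (\<lambda>X\<in>Obj A. \<lambda>x\<in>carrier (fobj F X). \<one>\<^bsub>fobj G X\<^esub>)"
  "Comp (Mod_cat A) F G H \<theta> \<eta> = (\<lambda>X\<in>Obj A. compose (carrier (fobj F X)) (\<theta> X) (\<eta> X))"
  "Ident (Mod_cat A) F = (\<lambda>X\<in>Obj A. \<lambda>x\<in>carrier (fobj F X). x)"
  by (simp_all add: Mod_cat_def functor_cat_def)

text \<open>The domain on which \<open>shrink\<close> is meaningful: without an injection into
  \<open>'u\<close>, the function chosen by \<open>encode\<close> is arbitrary.\<close>

definition embeddable_groups :: "'u itself \<Rightarrow> 'x monoid set"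
  where "embeddable_groups _ = {G. comm_group G \<and> (\<exists>c :: 'x \<Rightarrow> 'u. inj_on c (carrier G))}"

lemma inj_on_encode:
  assumes "\<exists>c :: 'x \<Rightarrow> 'u. inj_on c (carrier G)"
  shows "inj_on (encode G :: 'x \<Rightarrow> 'u) (carrier G)"
  unfolding encode_def using assms by (rule someI_ex)

lemma shrink_group_simps [simp]:
  "carrier (shrink_group G) = encode G ` carrier G"
  "\<one>\<^bsub>shrink_group G\<^esub> = encode G \<one>\<^bsub>G\<^esub>"
  by (simp_all add: shrink_group_def)

context
  fixes G :: "'x monoid" and TU :: "'u itself"
  assumes G: "G \<in> embeddable_groups TU"
begin

lemma embeddable_comm_group: "comm_group G"
  using G by (simp add: embeddable_groups_def)

lemma inj_on_encode_embeddable: "inj_on (encode G :: 'x \<Rightarrow> 'u) (carrier G)"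
  using G by (intro inj_on_encode) (simp add: embeddable_groups_def)

lemma encode_eq_iff:
  "\<lbrakk>x \<in> carrier G; y \<in> carrier G\<rbrakk> \<Longrightarrow> (encode G x :: 'u) = encode G y \<longleftrightarrow> x = y"
  using inj_on_encode_embeddable by (rule inj_on_eq_iff)

lemma decode_encode:
  "x \<in> carrier G \<Longrightarrow> inv_into (carrier G) (encode G) (encode G x :: 'u) = x"
  using inj_on_encode_embeddable by (rule inv_into_f_f)

lemma shrink_group_mult:
  "\<lbrakk>x \<in> carrier G; y \<in> carrier G\<rbrakk>
    \<Longrightarrow> (encode G x :: 'u) \<otimes>\<^bsub>shrink_group G\<^esub> encode G y = encode G (x \<otimes>\<^bsub>G\<^esub> y)"
  by (simp add: shrink_group_def decode_encode)

lemma shrink_comm_group: "comm_group (shrink_group G :: 'u monoid)"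
proof -
  interpret comm_group G by (rule embeddable_comm_group)
  show ?thesis
  proof (rule comm_groupI)
    fix a :: 'u assume "a \<in> carrier (shrink_group G)"
    then obtain x where x: "x \<in> carrier G" "a = encode G x" by auto
    then show "\<exists>b\<in>carrier (shrink_group G). b \<otimes>\<^bsub>shrink_group G\<^esub> a = \<one>\<^bsub>shrink_group G\<^esub>"
      by (intro bexI[of _ "encode G (inv\<^bsub>G\<^esub> x)"]) (auto simp: shrink_group_mult)
  qed (auto simp: shrink_group_mult m_ac)
qed

lemma fmap_shrink: "x \<in> carrier G \<Longrightarrow> fmap shrink G H f (encode G x :: 'u) = encode H (f x)"
  by (simp add: shrink_def decode_encode)

end

text \<open>On embeddable groups \<open>encode\<close> is an isomorphism onto the shrunken group and
  \<open>shrink\<close> acts on maps by conjugation with it. Composition with Hom functors then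
  produces modules.\<close>

lemma shrink_additive:
  "additive_functor (full_subcat ab_cat (embeddable_groups TYPE('u))) ab_cat
    (shrink :: ('x monoid, 'x \<Rightarrow> 'x, 'u monoid, 'u \<Rightarrow> 'u) func)"
  (is "additive_functor ?E ab_cat ?S")
proof -
  have S: "fobj ?S = shrink_group" by (simp add: shrink_def fun_eq_iff)
  have ext: "fmap ?S G H f \<in> extensional (encode G ` carrier G)" for G H f
    by (simp add: shrink_def)
  have eqI: "fmap ?S G H f = k"
    if "k \<in> extensional (encode G ` carrier G)" "\<And>x. x \<in> carrier G \<Longrightarrow> fmap ?S G H f (encode G x) = k (encode G x)"
    for G H f k
    using that by (intro extensionalityI[OF ext]) auto
  note [simp] = fmap_shrink[where TU = "TYPE('u)"] shrink_group_mult[where TU = "TYPE('u)"]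
    shrink_comm_group[where TU = "TYPE('u)"]
  have hom: "f x \<in> carrier H" if "f \<in> hom G H" "x \<in> carrier G" for f :: "'x \<Rightarrow> 'x" and G H x
    using that by (auto simp: hom_def)
  have mult [simp]: "x \<otimes>\<^bsub>G\<^esub> y \<in> carrier G"
    if "G \<in> embeddable_groups TYPE('u)" "x \<in> carrier G" "y \<in> carrier G" for G :: "'x monoid" and x y
    using that by (simp add: embeddable_groups_def comm_group.axioms(2) group.is_monoid monoid.m_closed)
  show ?thesis
    unfolding additive_functor_def is_functor_def S
  proof (intro conjI ballI)
    fix G assume G: "G \<in> Obj ?E"
    then show "shrink_group G \<in> Obj (ab_cat :: ('u monoid, 'u \<Rightarrow> 'u) category)"
      by (simp add: full_subcat_def)
    show "fmap ?S G G (Ident ?E G) = Ident ab_cat (shrink_group G)"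
      using G by (intro eqI) (simp_all add: full_subcat_def)
    fix H assume H: "H \<in> Obj ?E"
    show "fmap ?S G H f \<in> Mor ab_cat (shrink_group G) (shrink_group H)" if "f \<in> Mor ?E G H" for f
      using that G H ext[of G H f] by (auto simp: full_subcat_def hom_def Pi_iff)
    show "fmap ?S G H (f \<otimes>\<^bsub>Hom ?E G H\<^esub> g)
      = fmap ?S G H f \<otimes>\<^bsub>Hom ab_cat (shrink_group G) (shrink_group H)\<^esub> fmap ?S G H g"
      if "f \<in> Mor ?E G H" "g \<in> Mor ?E G H" for f g
      using that G H by (intro eqI) (simp_all add: full_subcat_def hom[of f G H] hom[of g G H])
    fix K assume K: "K \<in> Obj ?E"
    show "fmap ?S G K (Comp ?E G H K g f)
      = Comp ab_cat (shrink_group G) (shrink_group H) (shrink_group K) (fmap ?S H K g) (fmap ?S G H f)"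
      if "f \<in> Mor ?E G H" "g \<in> Mor ?E H K" for f g
      using that G H K by (intro eqI) (simp_all add: full_subcat_def hom[of f G H] compose_def)
  qed
qed

lemma additive_functor_full_subcat:
  "\<lbrakk>additive_functor A D F; \<And>X. X \<in> Obj A \<Longrightarrow> fobj F X \<in> S\<rbrakk>
    \<Longrightarrow> additive_functor A (full_subcat D S) F"
  unfolding additive_functor_def is_functor_def full_subcat_def by simp


subsection \<open>Exact sequences of modules\<close>

text \<open>The maps are restricted to \<open>S X\<close> because morphisms of \<open>ab_cat\<close>
  must be extensional on their carrier. Multiplication and unit remain those of N.\<close>

definition subfunctor :: "('o, 'm, 'u monoid, 'u \<Rightarrow> 'u) func \<Rightarrow> ('o \<Rightarrow> 'u set) \<Rightarrow> ('o, 'm, 'u monoid, 'u \<Rightarrow> 'u) func"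
  where "subfunctor N S = \<lparr>fobj = (\<lambda>X. (fobj N X)\<lparr>carrier := S X\<rparr>),
    fmap = (\<lambda>X Y f. restrict (fmap N X Y f) (S X))\<rparr>"

lemma comm_group_subgroup: "comm_group G \<Longrightarrow> subgroup H G \<Longrightarrow> comm_group (G\<lparr>carrier := H\<rparr>)"
  by (intro group.group_comm_groupI subgroup.subgroup_is_group)
    (auto intro: comm_group.axioms comm_monoid.m_comm subgroup.mem_carrier simp: comm_group.axioms(2))

locale submodule = preadditive_category C for C :: "('o, 'm) category" +
  fixes N :: "('o, 'm, 'u monoid, 'u \<Rightarrow> 'u) func" and S :: "'o \<Rightarrow> 'u set"
  assumes N: "additive_functor C ab_cat N"
    and S: "X \<in> Obj C \<Longrightarrow> subgroup (S X) (fobj N X)"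
    and stable: "\<lbrakk>X \<in> Obj C; Y \<in> Obj C; f \<in> Mor C X Y; x \<in> S X\<rbrakk> \<Longrightarrow> fmap N X Y f x \<in> S Y"
begin

lemma S_carrier: "X \<in> Obj C \<Longrightarrow> x \<in> S X \<Longrightarrow> x \<in> carrier (fobj N X)"
  using S subgroup.mem_carrier by metis

lemma S_mult: "X \<in> Obj C \<Longrightarrow> x \<in> S X \<Longrightarrow> y \<in> S X \<Longrightarrow> x \<otimes>\<^bsub>fobj N X\<^esub> y \<in> S X"
  using S subgroup.m_closed by metis

lemma fobj_comm_group: "X \<in> Obj C \<Longrightarrow> comm_group (fobj N X)"
  using N by (simp add: additive_functor_def is_functor_def)

lemma subfunctor_additive: "additive_functor C ab_cat (subfunctor N S)"
  using N stable S_carrier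
  unfolding additive_functor_def is_functor_def subfunctor_def
  by (auto simp: fobj_comm_group S comm_group_subgroup hom_def Pi_iff compose_def fun_eq_iff S_mult)

text \<open>The same family of functions serves for both codomains, so factoring through a kernel or
  an image requires no new map.\<close>

lemma nat_trans_subfunctor_iff:
  "nat_trans C ab_cat W (subfunctor N S) \<eta> \<longleftrightarrow>
    nat_trans C ab_cat W N \<eta> \<and> (\<forall>X\<in>Obj C. \<forall>x\<in>carrier (fobj W X). \<eta> X x \<in> S X)"
proof -
  have mor: "\<eta> X \<in> Mor ab_cat (fobj W X) (fobj (subfunctor N S) X) \<longleftrightarrow>
    \<eta> X \<in> Mor ab_cat (fobj W X) (fobj N X) \<and> (\<forall>x\<in>carrier (fobj W X). \<eta> X x \<in> S X)"
    if "X \<in> Obj C" for X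
    using that by (auto simp: hom_def subfunctor_def Pi_iff S_carrier)
  have comp: "compose (carrier (fobj W X)) (fmap (subfunctor N S) X Y f) (\<eta> X)
      = compose (carrier (fobj W X)) (fmap N X Y f) (\<eta> X)"
    if "\<forall>x\<in>carrier (fobj W X). \<eta> X x \<in> S X" for X Y f
    using that by (auto simp: compose_def subfunctor_def fun_eq_iff)
  show ?thesis
    unfolding nat_trans_def ab_cat_simps(5) by (auto simp: mor comp simp del: ab_cat_simps)
qed

end

section \<open>Natural transformations of modules in terms of elements\<close>

lemma nat_trans_hom:
  "nat_trans A ab_cat F G \<eta> \<Longrightarrow> X \<in> Obj A \<Longrightarrow> \<eta> X \<in> hom (fobj F X) (fobj G X)"
  by (simp add: nat_trans_def)

lemma nat_trans_extensional:
  "nat_trans A ab_cat F G \<eta> \<Longrightarrow> X \<in> Obj A \<Longrightarrow> \<eta> X \<in> extensional (carrier (fobj F X))"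
  by (simp add: nat_trans_def)

lemma nat_trans_closed:
  "\<lbrakk>nat_trans A ab_cat F G \<eta>; X \<in> Obj A; x \<in> carrier (fobj F X)\<rbrakk> \<Longrightarrow> \<eta> X x \<in> carrier (fobj G X)"
  by (rule hom_in_carrier[OF nat_trans_hom])

lemma nat_trans_natural:
  assumes "nat_trans A ab_cat F G \<eta>" "X \<in> Obj A" "Y \<in> Obj A" "f \<in> Mor A X Y" "x \<in> carrier (fobj F X)"
  shows "fmap G X Y f (\<eta> X x) = \<eta> Y (fmap F X Y f x)"
proof -
  have "compose (carrier (fobj F X)) (fmap G X Y f) (\<eta> X) = compose (carrier (fobj F X)) (\<eta> Y) (fmap F X Y f)"
    using assms by (simp add: nat_trans_def)
  from fun_cong[OF this, of x] show ?thesis using assms(5) by (simp add: compose_eq)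
qed

lemma nat_transI:
  assumes "\<And>X. X \<in> Obj A \<Longrightarrow> \<eta> X \<in> hom (fobj F X) (fobj G X)"
    and "\<And>X. X \<in> Obj A \<Longrightarrow> \<eta> X \<in> extensional (carrier (fobj F X))"
    and "\<And>X Y f x. X \<in> Obj A \<Longrightarrow> Y \<in> Obj A \<Longrightarrow> f \<in> Mor A X Y \<Longrightarrow> x \<in> carrier (fobj F X)
      \<Longrightarrow> fmap G X Y f (\<eta> X x) = \<eta> Y (fmap F X Y f x)"
  shows "nat_trans A ab_cat F G \<eta>"
  using assms by (auto simp: nat_trans_def compose_def fun_eq_iff)

lemma nat_trans_eqI:
  assumes "nat_trans A ab_cat F G \<eta>" "nat_trans A ab_cat F H \<theta>"
    and "\<eta> \<in> extensional (Obj A)" "\<theta> \<in> extensional (Obj A)"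
    and "\<And>X x. X \<in> Obj A \<Longrightarrow> x \<in> carrier (fobj F X) \<Longrightarrow> \<eta> X x = \<theta> X x"
  shows "\<eta> = \<theta>"
  using assms by (intro extensionalityI[of _ "Obj A"] extensionalityI[OF nat_trans_extensional nat_trans_extensional])

context
  fixes A :: "('o, 'm) category" and F :: "('o, 'm, 'u monoid, 'u \<Rightarrow> 'u) func"
  assumes F: "additive_functor A ab_cat F"
begin

lemma module_comm_group: "X \<in> Obj A \<Longrightarrow> comm_group (fobj F X)"
  using F by (simp add: additive_functor_def is_functor_def)

lemma module_hom:
  "\<lbrakk>X \<in> Obj A; Y \<in> Obj A; f \<in> Mor A X Y\<rbrakk> \<Longrightarrow> fmap F X Y f \<in> hom (fobj F X) (fobj F Y)"
  using F by (simp add: additive_functor_def is_functor_def)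

lemma module_closed:
  "\<lbrakk>X \<in> Obj A; Y \<in> Obj A; f \<in> Mor A X Y; x \<in> carrier (fobj F X)\<rbrakk> \<Longrightarrow> fmap F X Y f x \<in> carrier (fobj F Y)"
  by (rule hom_in_carrier[OF module_hom])

lemma nat_trans_ident: "nat_trans A ab_cat F F (Ident (Mod_cat A) F)"
  by (rule nat_transI) (auto simp: hom_def module_closed module_comm_group comm_group.axioms(2) group.is_monoid monoid.m_closed)

end

lemma nat_trans_comp:
  assumes F: "additive_functor A ab_cat F" and \<eta>: "nat_trans A ab_cat F G \<eta>" and \<theta>: "nat_trans A ab_cat G H \<theta>"
  shows "nat_trans A ab_cat F H (Comp (Mod_cat A) F G H \<theta> \<eta>)"
proof (rule nat_transI)
  fix X assume X: "X \<in> Obj A"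
  have "group (fobj F X)" using module_comm_group[OF F X] by (rule comm_group.axioms)
  then show "Comp (Mod_cat A) F G H \<theta> \<eta> X \<in> hom (fobj F X) (fobj H X)"
    using X nat_trans_hom[OF \<eta> X] nat_trans_hom[OF \<theta> X]
    by (auto simp: hom_def Pi_iff compose_eq group.is_monoid monoid.m_closed)
  show "Comp (Mod_cat A) F G H \<theta> \<eta> X \<in> extensional (carrier (fobj F X))" using X by simp
  fix Y f x assume "Y \<in> Obj A" "f \<in> Mor A X Y" "x \<in> carrier (fobj F X)"
  then show "fmap H X Y f (Comp (Mod_cat A) F G H \<theta> \<eta> X x) = Comp (Mod_cat A) F G H \<theta> \<eta> Y (fmap F X Y f x)"
    using X by (simp add: compose_eq nat_trans_closed[OF \<eta>] nat_trans_natural[OF \<theta>]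
        nat_trans_natural[OF \<eta>] module_closed[OF F])
qed

lemma hom_one_ab: "\<lbrakk>h \<in> hom G H; comm_group G; comm_group H\<rbrakk> \<Longrightarrow> h \<one>\<^bsub>G\<^esub> = \<one>\<^bsub>H\<^esub>"
  by (rule hom_one) (simp_all add: comm_group.axioms(2))

text \<open>Both universal properties are checked on elements. Elements of K are literally elements
  of H, so the inclusion is the identity family of K read with codomain H.\<close>

lemma (in preadditive_category) short_exact_kernel:
  fixes H Q :: "('o, 'm, 'u monoid, 'u \<Rightarrow> 'u) func"
  assumes H: "additive_functor C ab_cat H" and Q: "additive_functor C ab_cat Q"
    and p: "p \<in> Mor (Mod_cat C) H Q"
    and surj: "\<And>X. X \<in> Obj C \<Longrightarrow> p X ` carrier (fobj H X) = carrier (fobj Q X)"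
  defines "K \<equiv> subfunctor H (\<lambda>X. kernel (fobj H X) (fobj Q X) (p X))"
  shows "short_exact (Mod_cat C) K H Q (Ident (Mod_cat C) K) p"
proof -
  let ?S = "\<lambda>X. kernel (fobj H X) (fobj Q X) (p X)"
  let ?k = "Ident (Mod_cat C) K"
  note Hgr = module_comm_group[OF H] and Qgr = module_comm_group[OF Q]
  have pn: "nat_trans C ab_cat H Q p"
    using p by simp
  have ph: "group_hom (fobj H X) (fobj Q X) (p X)" if "X \<in> Obj C" for X
    using that Hgr Qgr nat_trans_hom[OF pn]
    by (simp add: group_hom_def group_hom_axioms_def comm_group.axioms(2))
  interpret K: submodule C H ?S
  proof (intro submodule.intro submodule_axioms.intro)
    show "preadditive_category C" by (rule preadditive_category_axioms)
    show "additive_functor C ab_cat H" by (rule H)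
    show "subgroup (?S X) (fobj H X)" if "X \<in> Obj C" for X
      using ph[OF that] by (rule group_hom.subgroup_kernel)
    show "fmap H X Y f x \<in> ?S Y" if "X \<in> Obj C" "Y \<in> Obj C" "f \<in> Mor C X Y" "x \<in> ?S X" for X Y f x
      using that module_closed[OF H] nat_trans_natural[OF pn, symmetric]
        hom_one_ab[OF module_hom[OF Q] Qgr Qgr] by (simp add: kernel_def)
  qed
  have K: "additive_functor C ab_cat K"
    unfolding K_def by (rule K.subfunctor_additive)
  have Kc: "carrier (fobj K X) = ?S X" "\<one>\<^bsub>fobj K X\<^esub> = \<one>\<^bsub>fobj H X\<^esub>" for X
    by (simp_all add: K_def subfunctor_def)
  have kn: "nat_trans C ab_cat K H ?k"
    using nat_trans_ident[OF K] K.nat_trans_subfunctor_iff[of K, folded K_def] by blast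
  have k: "?k \<in> Mor (Mod_cat C) K H" using kn by simp
  have pk: "Comp (Mod_cat C) K H Q p ?k = \<one>\<^bsub>Hom (Mod_cat C) K Q\<^esub>"
    by (auto simp: fun_eq_iff compose_def Kc kernel_def)
  have "is_kernel (Mod_cat C) H Q p K ?k"
    unfolding is_kernel_def
  proof (intro conjI ballI impI)
    fix W h assume W: "W \<in> Obj (Mod_cat C)" and h: "h \<in> Mor (Mod_cat C) W H"
      and h0: "Comp (Mod_cat C) W H Q p h = \<one>\<^bsub>Hom (Mod_cat C) W Q\<^esub>"
    have hn: "nat_trans C ab_cat W H h" and he: "h \<in> extensional (Obj C)" using h by simp_all
    have "p X (h X x) = \<one>\<^bsub>fobj Q X\<^esub>" if "X \<in> Obj C" "x \<in> carrier (fobj W X)" for X x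
      using fun_cong[OF fun_cong[OF h0, of X], of x] that by (simp add: compose_def)
    then have hS: "h X x \<in> ?S X" if "X \<in> Obj C" "x \<in> carrier (fobj W X)" for X x
      using that nat_trans_closed[OF hn] by (simp add: kernel_def)
    then have hK: "h \<in> Mor (Mod_cat C) W K"
      using hn he K.nat_trans_subfunctor_iff[of W, folded K_def] by simp
    \<comment> \<open>Composing with the inclusion leaves the family unchanged, which settles
      existence and uniqueness together.\<close>
    have kh: "Comp (Mod_cat C) W K H ?k h' = h'" if "h' \<in> Mor (Mod_cat C) W K" for h'
    proof (rule extensionalityI[of _ "Obj C"])
      fix X assume X: "X \<in> Obj C"
      have h'n: "nat_trans C ab_cat W K h'" using that by simp
      have "compose (carrier (fobj W X)) (\<lambda>x\<in>?S X. x) (h' X) = h' X"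
        using nat_trans_closed[OF h'n X] nat_trans_extensional[OF h'n X]
        by (intro extensionalityI[of _ "carrier (fobj W X)"]) (auto simp: compose_def Kc)
      then show "Comp (Mod_cat C) W K H ?k h' X = h' X" using X by (simp add: Kc)
    qed (use that in simp_all)
    show "\<exists>!h'. h' \<in> Mor (Mod_cat C) W K \<and> Comp (Mod_cat C) W K H ?k h' = h"
      using hK kh by metis
  qed (use K k pk in simp_all)
  moreover have "is_cokernel (Mod_cat C) K H ?k Q p"
    unfolding is_cokernel_def
  proof (intro conjI ballI impI)
    fix W h assume W: "W \<in> Obj (Mod_cat C)" and h: "h \<in> Mor (Mod_cat C) H W"
      and h0: "Comp (Mod_cat C) K H W h ?k = \<one>\<^bsub>Hom (Mod_cat C) K W\<^esub>"
    have hn: "nat_trans C ab_cat H W h" and he: "h \<in> extensional (Obj C)" using h by simp_all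
    have Wgr: "comm_group (fobj W X)" if "X \<in> Obj C" for X
      using W that module_comm_group by simp
    have hh: "group_hom (fobj H X) (fobj W X) (h X)" if "X \<in> Obj C" for X
      using that Hgr Wgr nat_trans_hom[OF hn]
      by (simp add: group_hom_def group_hom_axioms_def comm_group.axioms(2))
    have h1: "h X x = \<one>\<^bsub>fobj W X\<^esub>" if "X \<in> Obj C" "x \<in> ?S X" for X x
      using fun_cong[OF fun_cong[OF h0, of X], of x] that by (simp add: compose_def Kc)
    \<comment> \<open>Elements with the same image under \<open>p\<close> differ by an element of
      the kernel, where \<open>h\<close> vanishes. This makes the choice of preimages in the
      definition of \<open>h'\<close> harmless.\<close>
    have weld: "h X x = h X y"
      if X: "X \<in> Obj C" and xy: "x \<in> carrier (fobj H X)" "y \<in> carrier (fobj H X)" "p X x = p X y" for X x y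
    proof -
      interpret p: group_hom "fobj H X" "fobj Q X" "p X" using ph X .
      interpret h: group_hom "fobj H X" "fobj W X" "h X" using hh X .
      have "x \<otimes>\<^bsub>fobj H X\<^esub> inv\<^bsub>fobj H X\<^esub> y \<in> ?S X"
        using xy by (simp add: kernel_def)
      then have "h X x \<otimes>\<^bsub>fobj W X\<^esub> inv\<^bsub>fobj W X\<^esub> h X y = \<one>\<^bsub>fobj W X\<^esub>"
        using h1[OF X, of "x \<otimes>\<^bsub>fobj H X\<^esub> inv\<^bsub>fobj H X\<^esub> y"] xy by simp
      then show ?thesis
        using xy h.H.inv_equality[of "h X x" "inv\<^bsub>fobj W X\<^esub> h X y"] by simp
    qed
    define h' where "h' = (\<lambda>X\<in>Obj C. \<lambda>y\<in>carrier (fobj Q X). h X (inv_into (carrier (fobj H X)) (p X) y))"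
    have h'p: "h' X (p X x) = h X x" if X: "X \<in> Obj C" and x: "x \<in> carrier (fobj H X)" for X x
    proof -
      have px: "p X x \<in> p X ` carrier (fobj H X)" using x by blast
      then have "h X (inv_into (carrier (fobj H X)) (p X) (p X x)) = h X x"
        using x by (intro weld[OF X]) (auto intro: inv_into_into f_inv_into_f)
      then show ?thesis using X px surj[OF X] by (simp add: h'_def)
    qed
    have lift: "\<exists>x\<in>carrier (fobj H X). y = p X x" if "X \<in> Obj C" "y \<in> carrier (fobj Q X)" for X y
      using that surj by blast
    have h'n: "nat_trans C ab_cat Q W h'"
    proof (rule nat_transI)
      fix X assume X: "X \<in> Obj C"
      interpret p: group_hom "fobj H X" "fobj Q X" "p X" using ph X .
      interpret h: group_hom "fobj H X" "fobj W X" "h X" using hh X .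
      show "h' X \<in> hom (fobj Q X) (fobj W X)"
      proof (rule homI)
        fix y assume y: "y \<in> carrier (fobj Q X)"
        then obtain x where x: "x \<in> carrier (fobj H X)" "y = p X x" using lift[OF X] by blast
        then show "h' X y \<in> carrier (fobj W X)" using h'p[OF X] by simp
        fix y' assume y': "y' \<in> carrier (fobj Q X)"
        then obtain x' where x': "x' \<in> carrier (fobj H X)" "y' = p X x'" using lift[OF X] by blast
        have "y \<otimes>\<^bsub>fobj Q X\<^esub> y' = p X (x \<otimes>\<^bsub>fobj H X\<^esub> x')" using x x' by simp
        then show "h' X (y \<otimes>\<^bsub>fobj Q X\<^esub> y') = h' X y \<otimes>\<^bsub>fobj W X\<^esub> h' X y'"
          using x x' h'p[OF X] h'p[OF X, of "x \<otimes>\<^bsub>fobj H X\<^esub> x'"] by simp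
      qed
      show "h' X \<in> extensional (carrier (fobj Q X))" using X by (simp add: h'_def)
      fix Y f y assume Y: "Y \<in> Obj C" and f: "f \<in> Mor C X Y" and y: "y \<in> carrier (fobj Q X)"
      obtain x where x: "x \<in> carrier (fobj H X)" "y = p X x" using lift[OF X y] by blast
      have "fmap W X Y f (h' X y) = h Y (fmap H X Y f x)"
        using x h'p[OF X] nat_trans_natural[OF hn X Y f] by simp
      also have "\<dots> = h' Y (p Y (fmap H X Y f x))"
        using h'p[OF Y] module_closed[OF H X Y f] x by simp
      also have "\<dots> = h' Y (fmap Q X Y f y)"
        using nat_trans_natural[OF pn X Y f] x by simp
      finally show "fmap W X Y f (h' X y) = h' Y (fmap Q X Y f y)" .
    qed
    have comp_eq: "Comp (Mod_cat C) H Q W g p = h \<longleftrightarrow> (\<forall>X\<in>Obj C. \<forall>x\<in>carrier (fobj H X). g X (p X x) = h X x)" for g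
    proof
      assume "Comp (Mod_cat C) H Q W g p = h"
      then show "\<forall>X\<in>Obj C. \<forall>x\<in>carrier (fobj H X). g X (p X x) = h X x" by (auto simp: compose_def)
    next
      assume g: "\<forall>X\<in>Obj C. \<forall>x\<in>carrier (fobj H X). g X (p X x) = h X x"
      show "Comp (Mod_cat C) H Q W g p = h"
      proof (rule extensionalityI[of _ "Obj C"])
        fix X assume X: "X \<in> Obj C"
        have "compose (carrier (fobj H X)) (g X) (p X) = h X"
          using X g nat_trans_extensional[OF hn X]
          by (intro extensionalityI[of _ "carrier (fobj H X)"]) (auto simp: compose_def)
        then show "Comp (Mod_cat C) H Q W g p X = h X" using X by simp
      qed (use he in simp_all)
    qed
    show "\<exists>!h'. h' \<in> Mor (Mod_cat C) Q W \<and> Comp (Mod_cat C) H Q W h' p = h"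
    proof (rule ex1I[of _ h'])
      show "h' \<in> Mor (Mod_cat C) Q W \<and> Comp (Mod_cat C) H Q W h' p = h"
        unfolding comp_eq using h'n h'p by (simp add: h'_def)
      fix g assume g: "g \<in> Mor (Mod_cat C) Q W \<and> Comp (Mod_cat C) H Q W g p = h"
      then have gp: "\<forall>X\<in>Obj C. \<forall>x\<in>carrier (fobj H X). g X (p X x) = h X x"
        unfolding comp_eq by blast
      show "g = h'"
      proof (rule nat_trans_eqI)
        show "nat_trans C ab_cat Q W g" "g \<in> extensional (Obj C)" using g by simp_all
        show "nat_trans C ab_cat Q W h'" "h' \<in> extensional (Obj C)" using h'n by (simp_all add: h'_def)
        show "g X y = h' X y" if "X \<in> Obj C" "y \<in> carrier (fobj Q X)" for X y
          using lift[OF that] gp h'p that(1) by auto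
      qed
    qed
  next
    show "Comp (Mod_cat C) K H Q p ?k = \<one>\<^bsub>Hom (Mod_cat C) K Q\<^esub>" by (rule pk)
  qed (use Q p in simp_all)
  ultimately show ?thesis
    unfolding short_exact_def using H Q K k p by simp
qed

text \<open>The cokernel \<open>q\<close> factors through its image, and the resulting endomorphism of \<open>Q\<close> has to be
  the identity.\<close>

lemma (in preadditive_category) cokernel_surjective:
  fixes N Q :: "('o, 'm, 'u monoid, 'u \<Rightarrow> 'u) func"
  assumes N: "additive_functor C ab_cat N" and q: "is_cokernel (Mod_cat C) Z N f Q q" and X: "X \<in> Obj C"
  shows "q X ` carrier (fobj N X) = carrier (fobj Q X)"
proof -
  let ?S = "\<lambda>X. q X ` carrier (fobj N X)"
  let ?I = "subfunctor Q ?S"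
  have Q: "additive_functor C ab_cat Q" and qm: "q \<in> Mor (Mod_cat C) N Q"
    and qf: "Comp (Mod_cat C) Z N Q q f = \<one>\<^bsub>Hom (Mod_cat C) Z Q\<^esub>"
    and univ: "\<And>W h. W \<in> Obj (Mod_cat C) \<Longrightarrow> h \<in> Mor (Mod_cat C) N W \<Longrightarrow>
      Comp (Mod_cat C) Z N W h f = \<one>\<^bsub>Hom (Mod_cat C) Z W\<^esub> \<Longrightarrow>
      \<exists>!h'. h' \<in> Mor (Mod_cat C) Q W \<and> Comp (Mod_cat C) N Q W h' q = h"
    using q unfolding is_cokernel_def by auto
  have qn: "nat_trans C ab_cat N Q q" using qm by simp
  interpret I: submodule C Q ?S
  proof (intro submodule.intro submodule_axioms.intro)
    show "preadditive_category C" by (rule preadditive_category_axioms)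
    show "additive_functor C ab_cat Q" by (rule Q)
    show "subgroup (?S X) (fobj Q X)" if "X \<in> Obj C" for X
      using that nat_trans_hom[OF qn] module_comm_group[OF N] module_comm_group[OF Q]
      by (intro group_hom.img_is_subgroup)
        (simp add: group_hom_def group_hom_axioms_def comm_group.axioms(2))
    show "fmap Q X Y g y \<in> ?S Y" if "X \<in> Obj C" "Y \<in> Obj C" "g \<in> Mor C X Y" "y \<in> ?S X" for X Y g y
      using that nat_trans_natural[OF qn] module_closed[OF N] by auto
  qed
  have "?I \<in> Obj (Mod_cat C)" by (simp add: I.subfunctor_additive)
  moreover have "q \<in> Mor (Mod_cat C) N ?I"
    using qm I.nat_trans_subfunctor_iff[of N] by simp
  \<comment> \<open>The zero maps into the image and into Q are the same function, since both groups
    have the same unit.\<close>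
  moreover have "Comp (Mod_cat C) Z N ?I q f = \<one>\<^bsub>Hom (Mod_cat C) Z ?I\<^esub>"
    using qf by (simp add: subfunctor_def)
  ultimately obtain h where h: "h \<in> Mor (Mod_cat C) Q ?I" "Comp (Mod_cat C) N Q ?I h q = q"
    using univ by blast
  then have hQ: "h \<in> Mor (Mod_cat C) Q Q" "Comp (Mod_cat C) N Q Q h q = q"
    using I.nat_trans_subfunctor_iff[of Q h] by simp_all
  moreover have "Ident (Mod_cat C) Q \<in> Mor (Mod_cat C) Q Q"
    using nat_trans_ident[OF Q] by simp
  moreover have "Comp (Mod_cat C) N Q Q (Ident (Mod_cat C) Q) q = q"
  proof (rule extensionalityI[of _ "Obj C"])
    fix Y assume Y: "Y \<in> Obj C"
    have "compose (carrier (fobj N Y)) (\<lambda>x\<in>carrier (fobj Q Y). x) (q Y) = q Y"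
      using nat_trans_closed[OF qn Y] nat_trans_extensional[OF qn Y]
      by (intro extensionalityI[of _ "carrier (fobj N Y)"]) (auto simp: compose_def)
    then show "Comp (Mod_cat C) N Q Q (Ident (Mod_cat C) Q) q Y = q Y" using Y by simp
  qed (use qm in simp_all)
  moreover have "Q \<in> Obj (Mod_cat C)" using Q by simp
  then have "\<exists>!h'. h' \<in> Mor (Mod_cat C) Q Q \<and> Comp (Mod_cat C) N Q Q h' q = q"
    using univ qm qf by blast
  ultimately have "h = Ident (Mod_cat C) Q" by blast
  moreover have "\<forall>y\<in>carrier (fobj Q X). h X y \<in> ?S X"
    using h(1) I.nat_trans_subfunctor_iff[of Q h] X by simp
  ultimately show ?thesis
    using X nat_trans_closed[OF qn X] by auto
qed


section \<open>Exactness of the right adjoint of restriction\<close>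

lemma fobj_hom_module:
  "fobj (hom_module A D P) X = comp_func shrink (comp_func (hom_from D X) P)"
  by (simp add: hom_module_def comp_func_def postcomp_def precomp_def yoneda_def)

lemma fobj_hom_up:
  "fobj (fobj (hom_up A D P) N) X = shrink_group (Hom (Mod_cat A) (fobj (hom_module A D P) X) N)"
  by (simp add: hom_up_def comp_func_def postcomp_def precomp_def yoneda_def op_func_def
      hom_from_def op_cat_def shrink_def)

lemma fmap_hom_up:
  fixes Q N N' :: "('a, 'b, 'u monoid, 'u \<Rightarrow> 'u) func" and x :: 'u
  assumes "X \<in> Obj D" "Q \<in> Obj (Mod_cat A)" "fobj (hom_module A D P) X = Q"
  shows "fmap (hom_up A D P) N N' p X x = fmap shrink (Hom (Mod_cat A) Q N) (Hom (Mod_cat A) Q N')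
    (\<lambda>\<theta>\<in>Mor (Mod_cat A) Q N. Comp (Mod_cat A) Q N N' p \<theta>) x"
  using assms
  by (simp add: hom_up_def comp_func_def postcomp_def precomp_def yoneda_def op_func_def
      hom_from_def op_cat_def del: Mod_cat_simps)

text \<open>For \<open>N = C(X,-)/J(X,-)\<close> exactness lifts the identity of \<open>N\<close> along \<open>C(X,-) \<rightarrow> N\<close>. By the Yoneda
  lemma the lift is given by an element \<open>e\<close> of \<open>C(X,X)\<close>.\<close>

lemma (in category_ideal) exact_hom_up_idempotent:
  assumes emb: "\<And>X Y. X \<in> Obj C \<Longrightarrow> Y \<in> Obj C \<Longrightarrow> \<exists>c :: 'b \<Rightarrow> 'u. inj_on c (Mor C X Y)"
    and exact: "exact_functor (Mod_cat C :: (_, 'a \<Rightarrow> 'u \<Rightarrow> 'u) category) (Mod_cat quot)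
      (hom_up C quot (quotient_func C J))"
    and X: "X \<in> Obj C"
  shows "\<exists>e\<in>Mor C X X. Ident C X \<otimes>\<^bsub>Hom C X X\<^esub> inv\<^bsub>Hom C X X\<^esub> e \<in> J X X \<and>
    (\<forall>Y\<in>Obj C. \<forall>f\<in>J X Y. Comp C X X Y f e = \<one>\<^bsub>Hom C X Y\<^esub>)"
proof -
  interpret quot: preadditive_category quot by (rule quot_preadditive)
  let ?u = "TYPE('u)"
  define H :: "('a, 'b, 'u monoid, 'u \<Rightarrow> 'u) func" where "H = comp_func shrink (hom_from C X)"
  define Q :: "('a, 'b, 'u monoid, 'u \<Rightarrow> 'u) func"
    where "Q = comp_func shrink (comp_func (hom_from quot X) (quotient_func C J))"
  have embH: "Hom C X Y \<in> embeddable_groups ?u" if "Y \<in> Obj C" for Y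
    using emb[OF X that] X that by (simp add: embeddable_groups_def)
  have embQ: "Hom quot X Y \<in> embeddable_groups ?u" if Y: "Y \<in> Obj C" for Y
  proof -
    obtain c :: "'b \<Rightarrow> 'u" where "inj_on c (Mor C X Y)" using emb[OF X Y] by blast
    \<comment> \<open>A group of cosets embeds into \<open>'u\<close> by choosing a representative
      of each coset and embedding that.\<close>
    then have "inj_on (c \<circ> inv_into (Mor C X Y) (cls X Y)) (cls X Y ` Mor C X Y)"
      by (intro comp_inj_on inj_on_inv_into) (auto intro: inj_on_subset inv_into_into)
    then show ?thesis
      using X Y quot.hom_group[of X Y] Mor_quot[of X Y] unfolding embeddable_groups_def by auto
  qed
  have H: "additive_functor C ab_cat H"
    unfolding H_def
    by (intro additive_functor_comp[OF _ shrink_additive] additive_functor_full_subcat hom_from_additive X)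
      (simp add: hom_from_def embH)
  have Q: "additive_functor C ab_cat Q"
    unfolding Q_def
    by (intro additive_functor_comp[OF _ shrink_additive] additive_functor_full_subcat
          additive_functor_comp[OF quotient_func_additive] quot.hom_from_additive)
      (use X embQ in \<open>simp_all add: hom_from_def comp_func_def quotient_func_def\<close>)
  have fH: "fobj H Y = shrink_group (Hom C X Y)" for Y
    by (simp add: H_def comp_func_def hom_from_def shrink_def)
  have fQ: "fobj Q Y = shrink_group (Hom quot X Y)" for Y
    by (simp add: Q_def comp_func_def hom_from_def shrink_def quotient_func_def)
  let ?h = "\<lambda>Y. encode (Hom C X Y) :: 'b \<Rightarrow> 'u"
  let ?q = "\<lambda>Y f. encode (Hom quot X Y) (cls X Y f) :: 'u"
  have carH: "carrier (fobj H Y) = ?h Y ` Mor C X Y" for Y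
    by (simp add: fH)
  have carQ: "carrier (fobj Q Y) = ?q Y ` Mor C X Y" for Y
    unfolding fQ shrink_group_simps Mor_quot by blast
  have mapH: "fmap H Y Z g (?h Y f) = ?h Z (Comp C X Y Z g f)"
    if "Y \<in> Obj C" "Z \<in> Obj C" "f \<in> Mor C X Y" "g \<in> Mor C Y Z" for Y Z f g
    using that fmap_shrink[OF embH[of Y]] by (simp add: H_def comp_func_def hom_from_def)
  have mapQ: "fmap Q Y Z g (?q Y f) = ?q Z (Comp C X Y Z g f)"
    if "Y \<in> Obj C" "Z \<in> Obj C" "f \<in> Mor C X Y" "g \<in> Mor C Y Z" for Y Z f g
    using that X fmap_shrink[OF embQ[of Y]] Mor_quot[of X Y]
    by (simp add: Q_def comp_func_def hom_from_def quotient_func_def cls_comp del: quot_simps)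
  define p where "p = (\<lambda>Y\<in>Obj C. \<lambda>a\<in>carrier (fobj H Y). ?q Y (inv_into (Mor C X Y) (?h Y) a))"
  have p: "p Y (?h Y f) = ?q Y f" if "Y \<in> Obj C" "f \<in> Mor C X Y" for Y f
    using that decode_encode[OF embH] by (simp add: p_def carH)
  have pn: "nat_trans C ab_cat H Q p"
  proof (rule nat_transI)
    fix Y assume Y: "Y \<in> Obj C"
    show "p Y \<in> hom (fobj H Y) (fobj Q Y)"
    proof (rule homI)
      fix a assume "a \<in> carrier (fobj H Y)"
      then obtain f where f: "f \<in> Mor C X Y" "a = ?h Y f" unfolding carH by blast
      then show "p Y a \<in> carrier (fobj Q Y)" using p[OF Y] unfolding carQ by simp
      fix b assume "b \<in> carrier (fobj H Y)"
      then obtain g where g: "g \<in> Mor C X Y" "b = ?h Y g" unfolding carH by blast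
      have "p Y (a \<otimes>\<^bsub>fobj H Y\<^esub> b) = ?q Y (f \<otimes>\<^bsub>Hom C X Y\<^esub> g)"
        using f g X Y p[OF Y] by (simp add: fH shrink_group_mult[OF embH])
      also have "\<dots> = ?q Y f \<otimes>\<^bsub>fobj Q Y\<^esub> ?q Y g"
        using f g X Y Mor_quot[of X Y] by (simp add: fQ shrink_group_mult[OF embQ] cls_add del: quot_simps)
          (simp add: cls_add)
      finally show "p Y (a \<otimes>\<^bsub>fobj H Y\<^esub> b) = p Y a \<otimes>\<^bsub>fobj Q Y\<^esub> p Y b"
        using f g p[OF Y] by simp
    qed
    show "p Y \<in> extensional (carrier (fobj H Y))" using Y by (simp add: p_def)
    fix Z g a assume "Z \<in> Obj C" "g \<in> Mor C Y Z" "a \<in> carrier (fobj H Y)"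
    then show "fmap Q Y Z g (p Y a) = p Z (fmap H Y Z g a)"
      using X Y by (auto simp: carH p mapH mapQ simp del: quot_simps(2))
  qed
  have pm: "p \<in> Mor (Mod_cat C) H Q" using pn by (simp add: p_def)
  have "p Y ` carrier (fobj H Y) = carrier (fobj Q Y)" if "Y \<in> Obj C" for Y
    using p[OF that] unfolding carH carQ by (auto simp: image_iff)
  then obtain K k where short: "short_exact (Mod_cat C) K H Q k p"
    using short_exact_kernel[OF H Q pm] by blast
  let ?U = "hom_up C quot (quotient_func C J)
    :: (_, _, ('a, 'b set, 'u monoid, 'u \<Rightarrow> 'u) func, _) func"
  have Qm: "fobj (hom_module C quot (quotient_func C J)) X = Q"
    by (simp add: fobj_hom_module Q_def)
  have "is_cokernel (Mod_cat quot) (fobj ?U K) (fobj ?U H) (fmap ?U K H k) (fobj ?U Q) (fmap ?U H Q p)"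
    using exact short unfolding exact_functor_def short_exact_def by blast
  moreover have "additive_functor quot ab_cat (fobj ?U H)"
    using exact H unfolding exact_functor_def additive_functor_def[of "Mod_cat C"] is_functor_def[of "Mod_cat C"] by simp
  ultimately have surj: "fmap ?U H Q p X ` carrier (fobj (fobj ?U H) X) = carrier (fobj (fobj ?U Q) X)"
    using quot.cokernel_surjective X by (metis quot_simps(1))
  let ?HQ = "Hom (Mod_cat C) Q H" and ?QQ = "Hom (Mod_cat C) Q Q"
  have idQ: "Ident (Mod_cat C) Q \<in> carrier ?QQ"
    using nat_trans_ident[OF Q] by simp
  then have "(encode ?QQ (Ident (Mod_cat C) Q) :: 'u) \<in> fmap ?U H Q p X ` (encode ?HQ ` carrier ?HQ)"
    using surj unfolding fobj_hom_up Qm shrink_group_simps by blast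
  then obtain a :: 'u where a: "encode ?QQ (Ident (Mod_cat C) Q) = fmap ?U H Q p X a"
    "a \<in> encode ?HQ ` carrier ?HQ" by (rule imageE)
  \<comment> \<open>\<open>fmap shrink\<close> decodes \<open>a\<close> by the same
    \<open>inv_into\<close>, so \<open>s\<close> is the morphism that gets composed with
    \<open>p\<close>; only membership of \<open>a\<close> in the range is used here.\<close>
  define s where "s = inv_into (carrier ?HQ) (encode ?HQ) a"
  have s: "s \<in> Mor (Mod_cat C) Q H"
    unfolding s_def using a(2) by (rule inv_into_into)
  then have sn: "nat_trans C ab_cat Q H s" by simp
  have "fmap ?U H Q p X a = encode ?QQ (Comp (Mod_cat C) Q H Q p s)"
    using fmap_hom_up[OF _ _ Qm, of H Q p a] X Q s a(2)
    by (simp add: shrink_def s_def del: Mod_cat_simps(2,4,5))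
  then have enc: "(encode ?QQ (Comp (Mod_cat C) Q H Q p s) :: 'u) = encode ?QQ (Ident (Mod_cat C) Q)"
    using a(1) by simp
  \<comment> \<open>The class of the identity of X generates Q: acting on it by \<open>f\<close>
    gives the class of \<open>f\<close>.\<close>
  define q0 where "q0 = ?q X (Ident C X)"
  have q0: "q0 \<in> carrier (fobj Q X)"
    unfolding q0_def carQ using X by simp
  have gen: "fmap Q X Y f q0 = ?q Y f" if "Y \<in> Obj C" "f \<in> Mor C X Y" for Y f
    unfolding q0_def using mapQ[OF X that(1) ident_closed[OF X] that(2)] X that by simp
  \<comment> \<open>An endomorphism of Q is determined by its value at the generator, an element of
    \<open>'u\<close>. Thus the endomorphisms embed into \<open>'u\<close>, their encoding is
    injective, and the equality \<open>enc\<close> yields p s = 1.\<close>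
  have "inj_on (\<lambda>\<eta>. \<eta> X q0) (carrier ?QQ)"
  proof (rule inj_onI)
    fix \<eta> \<theta> assume \<eta>: "\<eta> \<in> carrier ?QQ" and \<theta>: "\<theta> \<in> carrier ?QQ" and eq: "\<eta> X q0 = \<theta> X q0"
    show "\<eta> = \<theta>"
    proof (rule nat_trans_eqI)
      show \<eta>n: "nat_trans C ab_cat Q Q \<eta>" and \<theta>n: "nat_trans C ab_cat Q Q \<theta>"
        and "\<eta> \<in> extensional (Obj C)" "\<theta> \<in> extensional (Obj C)"
        using \<eta> \<theta> by simp_all
      fix Y y assume Y: "Y \<in> Obj C" and "y \<in> carrier (fobj Q Y)"
      then obtain f where f: "f \<in> Mor C X Y" "y = fmap Q X Y f q0"
        using gen[OF Y] unfolding carQ by auto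
      then show "\<eta> Y y = \<theta> Y y"
        using nat_trans_natural[OF \<eta>n X Y f(1) q0] nat_trans_natural[OF \<theta>n X Y f(1) q0] eq by simp
    qed
  qed
  then have inj: "inj_on (encode ?QQ :: _ \<Rightarrow> 'u) (carrier ?QQ)"
    by (intro inj_on_encode) blast
  have psm: "Comp (Mod_cat C) Q H Q p s \<in> carrier ?QQ"
    using nat_trans_comp[OF Q sn pn] by simp
  have "Comp (Mod_cat C) Q H Q p s = Ident (Mod_cat C) Q"
    using inj_onD[OF inj enc psm idQ] .
  from fun_cong[OF fun_cong[OF this, of X], of q0] have ps: "p X (s X q0) = q0"
    using X q0 by (simp add: compose_eq)
  \<comment> \<open>The Yoneda element of the section: p s = 1 evaluated at the generator says that
    \<open>e\<close> and the identity have the same class.\<close>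
  obtain e where e: "e \<in> Mor C X X" "s X q0 = ?h X e"
    using nat_trans_closed[OF sn X q0] unfolding carH by blast
  have "?q X (Ident C X) = ?q X e"
    using ps p[OF X e(1)] e(2) by (simp add: q0_def)
  then have "cls X X (Ident C X) = cls X X e"
    using encode_eq_iff[OF embQ[OF X]] e X unfolding Mor_quot by simp
  then have "Ident C X \<otimes>\<^bsub>Hom C X X\<^esub> inv\<^bsub>Hom C X X\<^esub> e \<in> J X X"
    using cls_eqD X e by simp
  moreover have "Comp C X X Y f e = \<one>\<^bsub>Hom C X Y\<^esub>" if Y: "Y \<in> Obj C" and fJ: "f \<in> J X Y" for Y f
  proof -
    have f: "f \<in> Mor C X Y" using J_closed X Y fJ by blast
    \<comment> \<open>Naturality moves \<open>f\<close> inside: f e encodes f s(q0) = s(f q0), and f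
      q0 is the class of \<open>f\<close>, which is zero.\<close>
    have "?h Y (Comp C X X Y f e) = fmap H X Y f (s X q0)"
      using mapH X Y f e by simp
    also have "\<dots> = s Y (?q Y f)"
      using nat_trans_natural[OF sn X Y f q0] gen[OF Y f] by simp
    also have "?q Y f = \<one>\<^bsub>fobj Q Y\<^esub>"
      using cls_eq_zero[OF X Y fJ] by (simp add: fQ)
    also have "s Y \<one>\<^bsub>fobj Q Y\<^esub> = \<one>\<^bsub>fobj H Y\<^esub>"
      using nat_trans_hom[OF sn Y] module_comm_group[OF Q Y] module_comm_group[OF H Y] by (rule hom_one_ab)
    also have "\<dots> = ?h Y \<one>\<^bsub>Hom C X Y\<^esub>" by (simp add: fH)
    finally show ?thesis
      using encode_eq_iff[OF embH[OF Y]] X Y f e by simp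
  qed
  ultimately show ?thesis using e by blast
qed

text \<open>Smallness bounds the set of functions from M to \<open>'u\<close>. It contains a copy of
  M, namely the functions taking one of two distinct values at a single point and the other
  elsewhere.\<close>

lemma small_embeds:
  assumes "infinite (UNIV :: 'u set)" "small TYPE('u) M"
  shows "\<exists>c :: 'a \<Rightarrow> 'u. inj_on c M"
proof -
  obtain a b :: 'u where ab: "a \<noteq> b"
    using assms(1) by (metis UNIV_I finite.simps finite_subset singletonI subsetI)
  obtain d :: "('a \<Rightarrow> 'u) \<Rightarrow> 'u" where d: "inj_on d (M \<rightarrow>\<^sub>E UNIV)"
    using assms(2) unfolding small_def lepoll_def by blast
  have "inj_on (\<lambda>m. \<lambda>x\<in>M. if x = m then a else b) M"
  proof (rule inj_onI)
    fix m n assume m: "m \<in> M"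
      and eq: "(\<lambda>x\<in>M. if x = m then a else b) = (\<lambda>x\<in>M. if x = n then a else b)"
    show "m = n"
      using m ab fun_cong[OF eq, of m] by (simp split: if_splits)
  qed
  then have "inj_on (d \<circ> (\<lambda>m. \<lambda>x\<in>M. if x = m then a else b)) M"
    by (rule comp_inj_on) (rule inj_on_subset[OF d], auto)
  then show ?thesis by blast
qed

lemma (in preadditive_category) hom_embeds:
  assumes "infinite (UNIV :: 'u set)" "skeletally_small TYPE('u) C" and X: "X \<in> Obj C" and Y: "Y \<in> Obj C"
  shows "\<exists>c :: 'm \<Rightarrow> 'u. inj_on c (Mor C X Y)"
proof -
  obtain X' Y' where X': "X' \<in> Obj C" "isomorphic C X X'" and Y': "Y' \<in> Obj C" "isomorphic C Y Y'"
    and small: "small TYPE('u) (Mor C X' Y')"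
    using assms unfolding skeletally_small_def by (metis subsetD)
  obtain a a' where a: "a \<in> Mor C X X'" "a' \<in> Mor C X' X" "Comp C X X' X a' a = Ident C X"
    using X' unfolding isomorphic_def is_iso_def by blast
  obtain b b' where b: "b \<in> Mor C Y Y'" "b' \<in> Mor C Y' Y" "Comp C Y Y' Y b' b = Ident C Y"
    using Y' unfolding isomorphic_def is_iso_def by blast
  define t where "t = (\<lambda>f. Comp C X' Y Y' b (Comp C X' X Y f a'))"
  have "Comp C X Y' Y b' (Comp C X X' Y' (t f) a) = f" if f: "f \<in> Mor C X Y" for f
  proof -
    have "Comp C X Y' Y b' (Comp C X X' Y' (t f) a)
      = Comp C X Y Y (Comp C Y Y' Y b' b) (Comp C X X Y f (Comp C X X' X a' a))"
      using X Y X' Y' a(1,2) b(1,2) f by (simp add: t_def flip: comp_assoc)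
    then show ?thesis using X Y a b f by simp
  qed
  then have "inj_on t (Mor C X Y)" by (rule inj_on_inverseI)
  moreover obtain c :: "'m \<Rightarrow> 'u" where "inj_on c (Mor C X' Y')"
    using small_embeds[OF assms(1) small] by blast
  moreover have "t ` Mor C X Y \<subseteq> Mor C X' Y'"
    using X Y X' Y' a b by (auto simp: t_def)
  ultimately have "inj_on (c \<circ> t) (Mor C X Y)"
    using comp_inj_on inj_on_subset by metis
  then show ?thesis by blast
qed

theorem theorem5p4:
  fixes C :: "('o, 'm) category" and B :: "'o set"
    and T_C T_B :: "(('o, 'm, 'u monoid, 'u \<Rightarrow> 'u) func \<times> ('o, 'm, 'u monoid, 'u \<Rightarrow> 'u) func,
      ('o \<Rightarrow> 'u \<Rightarrow> 'u) \<times> ('o \<Rightarrow> 'u \<Rightarrow> 'u), 'u monoid, 'u \<Rightarrow> 'u) func"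
  defines "Bcat \<equiv> full_subcat C B"
  defines "CI \<equiv> quotient_cat C (factor_ideal C B)"
  defines "\<pi> \<equiv> quotient_func C (factor_ideal C B)"
  assumes universe: "infinite (UNIV :: 'u set)"
    and "additive_category C"
    and "skeletally_small TYPE('u) C"
    and "krull_schmidt C"
    and "split_idempotents C"
    and "B \<subseteq> Obj C"
    and "additive_category Bcat"
    and "add_closure C B = B"
    and "is_tensor_product C T_C"
    and "is_tensor_product Bcat T_B"
    and "recollement (Mod_cat CI :: (_, 'o \<Rightarrow> 'u \<Rightarrow> 'u) category) (Mod_cat C) (Mod_cat Bcat)
      (tensor_up T_C C CI \<pi>) (precomp C \<pi>) (hom_up C CI \<pi>)
      (tensor_up T_B Bcat C id_func) (precomp Bcat id_func) (hom_up Bcat C id_func)"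
    and "exact_functor (Mod_cat C :: (_, 'o \<Rightarrow> 'u \<Rightarrow> 'u) category) (Mod_cat CI) (hom_up C CI \<pi>)"
  shows "equivalent_categories C
    (tri_matrix_cat Bcat (full_subcat C (left_perp C B)) (hom_bifunctor C))"
proof -
  interpret preadditive_category C
    using \<open>additive_category C\<close> unfolding additive_category_def by blast
  interpret category_ideal C "factor_ideal C B"
    using \<open>B \<subseteq> Obj C\<close> \<open>additive_category Bcat\<close> unfolding Bcat_def
    by (rule category_ideal_factor_ideal)
  show ?thesis
    unfolding Bcat_def
  proof (rule equivalent_tri_matrix_cat[OF _ \<open>B \<subseteq> Obj C\<close>])
    show "\<exists>P. direct_sum C [X, Y] P" if "X \<in> Obj C" "Y \<in> Obj C" for X Y
      using \<open>additive_category C\<close> that unfolding additive_category_def by blast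
    fix X assume X: "X \<in> Obj C"
    obtain e where "e \<in> Mor C X X"
      "Ident C X \<otimes>\<^bsub>Hom C X X\<^esub> inv\<^bsub>Hom C X X\<^esub> e \<in> factor_ideal C B X X"
      "\<And>Y f. Y \<in> Obj C \<Longrightarrow> f \<in> factor_ideal C B X Y \<Longrightarrow> Comp C X X Y f e = \<one>\<^bsub>Hom C X Y\<^esub>"
      using exact_hom_up_idempotent[OF
          hom_embeds[OF universe \<open>skeletally_small TYPE('u) C\<close>]
          \<open>exact_functor (Mod_cat C) (Mod_cat CI) (hom_up C CI \<pi>)\<close>[unfolded CI_def \<pi>_def] X]
      by blast
    then show "\<exists>K\<in>B. \<exists>L\<in>left_perp C B. \<exists>k l p q. biproduct C K L X k l p q"
      by (rule decomposition_of_idempotent[OF \<open>split_idempotents C\<close> \<open>B \<subseteq> Obj C\<close> \<open>add_closure C B = B\<close> X])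
  qed
qed

end
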